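(* Let $F$ be a finite field with $q$ elements, $q$ odd. For $n\geq 2$, the isoperimetric constant of $\mathrm{Um}(F^n)$ satisfies \[ \mathrm{iso}(\mathrm{Um}(F^n))=\tfrac12\big(q^{n-1}-q^{(n-1)/2}\big)\ \text{ if } n \text{ is odd},\qquad \tfrac12\big(q^{n-1}-q^{n/2-1}\big)\geq \mathrm{iso}(\mathrm{Um}(F^n))\geq \tfrac12\big(q^{n-1}-q^{(n-1)/2}\big)\ \text{ if } n \text{ is even}. \] For $n\geq 3$, the isoperimetric constant of $\mathrm{Um}_0(F^n)$ satisfies \[ \mathrm{iso}(\mathrm{Um}_0(F^n))\geq \tfrac12\Big(\tfrac{q^{n-1}-1}{q-1}-q^{n/2-1}\Big)\ \text{ if } n \text{ is odd},\qquad \mathrm{iso}(\mathrm{Um}_0(F^n))= \tfrac12\Big(\tfrac{q^{n-1}-1}{q-1}-q^{n/2-1}\Big)\ \text{ if } n \text{ is even}. \]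
   Context: Dot product on $F^n$: $a\cdot b=\sum_i a_ib_i$. $\mathrm{Um}(F^n)$ ($n\geq2$) is the bipartite graph on two copies $\{a_\bullet\},\{b_\circ\}$ of $F^n\setminus\{0\}$ with $a_\bullet\sim b_\circ$ iff $a\cdot b=1$. $\mathrm{Um}_0(F^n)$ ($n\geq 3$) is the bipartite graph on two copies of $(F^n\setminus\{0\})/F^*$ with $[a]_\bullet\sim[b]_\circ$ iff $a\cdot b=0$. For a connected graph $X$, $\mathrm{iso}(X)=\min e(U,W)/\min\{|U|,|W|\}$, the minimum over all partitions of the vertex set into two non-empty sets $U,W$, where $e(U,W)$ is the number of edges joining a vertex of $U$ to a vertex of $W$. *)

theory Defs
  imports "HOL-Analysis.Analysis"
begin

text \<open>A graph is a pair consisting of its vertex set and its set of (unordered) edges, each edge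
  being the set of its two endpoints.\<close>

type_synonym 'v graph = "'v set \<times> 'v set set"

definition edges_between :: "'v graph \<Rightarrow> 'v set \<Rightarrow> 'v set \<Rightarrow> nat" where
  "edges_between X U W = card {e \<in> snd X. \<exists>u\<in>U. \<exists>w\<in>W. e = {u, w}}"

text \<open>Only meaningful for finite graphs with at least two vertices, where the minimum is over a
  finite non-empty set.\<close>

definition isoperimetric :: "'v graph \<Rightarrow> real" where
  "isoperimetric X = Min {real (edges_between X U W) / real (min (card U) (card W)) | U W.
      U \<noteq> {} \<and> W \<noteq> {} \<and> U \<inter> W = {} \<and> U \<union> W = fst X}"

definition dot :: "'a::field ^ 'n \<Rightarrow> 'a ^ 'n \<Rightarrow> 'a" where
  "dot a b = (\<Sum>i\<in>UNIV. a $ i * b $ i)"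

text \<open>In both graphs \<open>Inl\<close> tags the copy written with a filled circle and \<open>Inr\<close> the copy
  written with an empty circle.\<close>

definition Um :: "('a::field ^ 'n + 'a ^ 'n) graph" where
  "Um = ((UNIV - {0}) <+> (UNIV - {0}),
         {{Inl a, Inr b} | a b. a \<noteq> 0 \<and> b \<noteq> 0 \<and> dot a b = 1})"

definition proportional :: "('a::field ^ 'n) rel" where
  "proportional = {(a, b). a \<noteq> 0 \<and> b \<noteq> 0 \<and> (\<exists>c. c \<noteq> 0 \<and> b = c *s a)}"

definition Um0 :: "(('a::field ^ 'n) set + ('a ^ 'n) set) graph" where
  "Um0 = (((UNIV - {0}) // proportional) <+> ((UNIV - {0}) // proportional),
          {{Inl (proportional `` {a}), Inr (proportional `` {b})} | a b.
             a \<noteq> 0 \<and> b \<noteq> 0 \<and> dot a b = 0})"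

lemma equiv_proportional:
  "equiv (UNIV - {0}) (proportional :: ('a::field ^ 'n) rel)"
proof (rule equivI)
  show "proportional \<subseteq> (UNIV - {0}) \<times> (UNIV - {0 :: 'a ^ 'n})"
    by (auto simp: proportional_def)
  show "refl_on (UNIV - {0}) (proportional :: ('a ^ 'n) rel)"
    by (auto simp: refl_on_def proportional_def intro!: exI[of _ 1])
  show "sym (proportional :: ('a ^ 'n) rel)"
  proof (rule symI)
    fix a b :: "'a ^ 'n" assume "(a, b) \<in> proportional"
    then obtain c where "a \<noteq> 0" "b \<noteq> 0" "c \<noteq> 0" "b = c *s a"
      by (auto simp: proportional_def)
    then show "(b, a) \<in> proportional"
      by (auto simp: proportional_def vector_smult_assoc intro!: exI[of _ "inverse c"])
  qed
  show "trans (proportional :: ('a ^ 'n) rel)"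
  proof (rule transI)
    fix x y z :: "'a ^ 'n" assume "(x, y) \<in> proportional" "(y, z) \<in> proportional"
    then obtain c d where "x \<noteq> 0" "z \<noteq> 0" "c \<noteq> 0" "y = c *s x" "d \<noteq> 0" "z = d *s y"
      by (auto simp: proportional_def)
    then show "(x, z) \<in> proportional"
      by (auto simp: proportional_def vector_smult_assoc intro!: exI[of _ "d * c"])
  qed
qed

lemma dot_eq_0_cong:
  assumes "(a, a') \<in> proportional" "(b, b') \<in> proportional"
  shows "dot a b = 0 \<longleftrightarrow> dot a' b' = 0"
proof -
  obtain c d where cd: "c \<noteq> 0" "d \<noteq> 0" "a' = c *s a" "b' = d *s b"
    using assms by (auto simp: proportional_def)
  have "dot a' b' = c * d * dot a b"
    by (simp add: dot_def cd sum_distrib_left algebra_simps)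
  with cd show ?thesis by simp
qed

end

theory Submission
  imports Defs "HOL-Algebra.Algebraic_Closure_Type"
begin

text \<open>Both graphs are regular and bipartite, and counting the common neighbours of two vertices
  diagonalises the square of the biadjacency operator. The lower bounds are the spectral gap
  inequality \<open>iso \<ge> (d - l) / 2\<close>, with \<open>l\<close> the second singular value.

  The upper bounds come from \<open>\<plusminus>1\<close>-valued singular vectors: the two sign classes of such a vector,
  taken on both sides, form a balanced partition for which the ratio is \<open>(d - \<bar>s\<bar>) / 2\<close>, where
  \<open>s\<close> is the singular value. Identify \<open>F\<^sup>n\<close> with the field \<open>K\<close> of \<open>q\<^sup>n\<close> elements and the dot
  product with \<open>(x, y) \<mapsto> L (x y)\<close> for a nonzero linear functional \<open>L\<close>. The quadratic character of
  \<open>K\<close> is then a singular vector, because substituting \<open>z = x y\<close> in the sum over \<open>L (x y) = t\<close>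
  takes out a factor \<open>\<chi> y\<close>. On \<open>F\<close> the character is trivial for even \<open>n\<close> and nontrivial for odd
  \<open>n\<close>; this decides to which eigenspace it belongs, hence the value of \<open>s\<^sup>2\<close>.\<close>


section \<open>Regular bipartite graphs\<close>

text \<open>Write T for the biadjacency operator, J for the all-ones operator and P for summation
  over orbits of nonzero scalars (\<open>line_sum\<close>). For \<open>Um\<close>, T^t T = q^(n-1) I
  + q^(n-2) (J - P). On functions of sum zero this is q^(n-1) where line sums vanish, and q^(n-2) on
  functions constant on lines, since P is q - 1 there. A character nontrivial on F has zero line
  sums, so for odd n it realises the larger value and the bounds meet; for even n it is constant on
  lines and reaches only the smaller one, which leaves the gap. For \<open>Um0\<close> every
  function is constant on lines, so the sum-zero functions form a single eigenspace, and the
  character descends to points exactly for even n. This is why the two graphs exchange parities. No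
  Gauss sum is evaluated: the absolute value of s comes from comparing norms in T h = s h'.\<close>

definition bipartite_graph :: "'v set \<Rightarrow> 'w set \<Rightarrow> ('v \<Rightarrow> 'w \<Rightarrow> bool) \<Rightarrow> ('v + 'w) graph" where
  "bipartite_graph A B R = (A <+> B, {{Inl a, Inr b} | a b. a \<in> A \<and> b \<in> B \<and> R a b})"

lemma edges_between_commute: "edges_between G U W = edges_between G W U"
  unfolding edges_between_def by (rule arg_cong[of _ _ card]) (auto simp: insert_commute)

text \<open>The tags \<open>Inl\<close> and \<open>Inr\<close> make a pair recoverable from its
  edge, so no edge is counted twice; an edge crosses the cut exactly when one of its ends lies in
  \<open>A1 <+> B1\<close> and the other does not.\<close>

lemma edges_between_bipartite_graph:
  assumes "A1 \<subseteq> A" "B1 \<subseteq> B"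
  shows "edges_between (bipartite_graph A B R) (A1 <+> B1) ((A - A1) <+> (B - B1))
    = card {(a, b) \<in> A \<times> B. R a b \<and> (a \<in> A1) \<noteq> (b \<in> B1)}"
proof -
  have "{e \<in> snd (bipartite_graph A B R). \<exists>u\<in>A1 <+> B1. \<exists>w\<in>(A - A1) <+> (B - B1). e = {u, w}}
    = (\<lambda>(a, b). {Inl a, Inr b}) ` {(a, b) \<in> A \<times> B. R a b \<and> (a \<in> A1) \<noteq> (b \<in> B1)}"
    (is "?L = ?f ` ?S")
  proof (intro equalityI subsetI)
    fix e assume "e \<in> ?L"
    then obtain a b u w where *: "e = {Inl a, Inr b}" "a \<in> A" "b \<in> B" "R a b"
      "u \<in> A1 <+> B1" "w \<in> (A - A1) <+> (B - B1)" "e = {u, w}"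
      by (auto simp: bipartite_graph_def)
    then have "(u = Inl a \<and> w = Inr b) \<or> (u = Inr b \<and> w = Inl a)"
      by (auto simp: doubleton_eq_iff)
    with * have "(a, b) \<in> ?S" by auto
    then show "e \<in> ?f ` ?S" by (rule rev_image_eqI) (simp add: *(1))
  next
    fix e assume "e \<in> ?f ` ?S"
    then obtain a b where *: "e = {Inl a, Inr b}" "a \<in> A" "b \<in> B" "R a b"
      "(a \<in> A1) \<noteq> (b \<in> B1)" by (elim imageE) (simp split: prod.splits)
    then have "\<exists>u\<in>A1 <+> B1. \<exists>w\<in>(A - A1) <+> (B - B1). e = {u, w}"
      by (cases "a \<in> A1") (auto simp: insert_commute)
    moreover have "e \<in> snd (bipartite_graph A B R)"
      using * by (auto simp: bipartite_graph_def)
    ultimately show "e \<in> ?L" by blast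
  qed
  moreover have "inj_on ?f ?S"
    by (auto simp: inj_on_def doubleton_eq_iff)
  ultimately show ?thesis
    by (simp add: edges_between_def card_image)
qed

lemma sum_swap_relation:
  assumes "finite A" "finite B"
  shows "(\<Sum>b\<in>B. \<Sum>a\<in>{a\<in>A. R a b}. g a b) = (\<Sum>a\<in>A. \<Sum>b\<in>{b\<in>B. R a b}. g a b)"
proof -
  have "(\<Sum>b\<in>B. \<Sum>a\<in>{a\<in>A. R a b}. g a b) = (\<Sum>b\<in>B. \<Sum>a\<in>A. if R a b then g a b else 0)"
    using assms by (simp add: sum.inter_filter)
  also have "\<dots> = (\<Sum>a\<in>A. \<Sum>b\<in>B. if R a b then g a b else 0)"
    by (rule sum.swap)
  also have "\<dots> = (\<Sum>a\<in>A. \<Sum>b\<in>{b\<in>B. R a b}. g a b)"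
    using assms by (simp add: sum.inter_filter)
  finally show ?thesis .
qed

lemma sum_indicator_subset:
  assumes "finite A" "S \<subseteq> A"
  shows "(\<Sum>a\<in>A. indicator S a) = real (card S)"
  using assms by (simp add: indicator_def sum.If_cases Int_absorb1)

locale regular_bipartite =
  fixes A :: "'v set" and B :: "'w set" and R :: "'v \<Rightarrow> 'w \<Rightarrow> bool" and d m :: real
  assumes finite_A: "finite A" and finite_B: "finite B"
    and card_A: "real (card A) = m" and card_B: "real (card B) = m" and m_pos: "m > 0"
    and degree_B: "b \<in> B \<Longrightarrow> real (card {a\<in>A. R a b}) = d"
    and degree_A: "a \<in> A \<Longrightarrow> real (card {b\<in>B. R a b}) = d"
begin

text \<open>The bilinear form of the biadjacency matrix. On indicators it counts the edges between
  \<open>A1\<close> and \<open>B1\<close>, that is, inside \<open>A1 <+> B1\<close>.\<close>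

definition pairing :: "('v \<Rightarrow> real) \<Rightarrow> ('w \<Rightarrow> real) \<Rightarrow> real" where
  "pairing x y = (\<Sum>b\<in>B. (\<Sum>a\<in>{a\<in>A. R a b}. x a) * y b)"

lemma pairing_const_right: "pairing x (\<lambda>_. c) = d * c * (\<Sum>a\<in>A. x a)"
proof -
  have "pairing x (\<lambda>_. c) = (\<Sum>b\<in>B. \<Sum>a\<in>{a\<in>A. R a b}. x a * c)"
    by (simp add: pairing_def sum_distrib_right)
  also have "\<dots> = (\<Sum>a\<in>A. \<Sum>b\<in>{b\<in>B. R a b}. x a * c)"
    by (rule sum_swap_relation[OF finite_A finite_B])
  also have "\<dots> = d * c * (\<Sum>a\<in>A. x a)"
    by (simp add: degree_A sum_distrib_left mult_ac)
  finally show ?thesis .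
qed

lemma pairing_const_left: "pairing (\<lambda>_. c) y = d * c * (\<Sum>b\<in>B. y b)"
  by (simp add: pairing_def degree_B sum_distrib_left mult_ac)

lemma pairing_add_left: "pairing (\<lambda>a. x a + x' a) y = pairing x y + pairing x' y"
  by (simp add: pairing_def sum.distrib ring_distribs)

lemma pairing_add_right: "pairing x (\<lambda>b. y b + y' b) = pairing x y + pairing x y'"
  by (simp add: pairing_def sum.distrib ring_distribs)

text \<open>The degrees in the part add up to its crossing edges plus twice its inner edges.\<close>

lemma edges_between_eq_pairing:
  assumes "A1 \<subseteq> A" "B1 \<subseteq> B"
  shows "real (edges_between (bipartite_graph A B R) (A1 <+> B1) ((A - A1) <+> (B - B1)))
    = d * (card A1 + card B1) - 2 * pairing (indicator A1) (indicator B1)"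
proof -
  let ?i = "indicator A1 :: _ \<Rightarrow> real" and ?j = "indicator B1 :: _ \<Rightarrow> real"
  have "{(a, b) \<in> A \<times> B. R a b \<and> (a \<in> A1) \<noteq> (b \<in> B1)} =
      {p \<in> A \<times> B. R (fst p) (snd p) \<and> (fst p \<in> A1) \<noteq> (snd p \<in> B1)}" by auto
  then have "real (card {(a, b) \<in> A \<times> B. R a b \<and> (a \<in> A1) \<noteq> (b \<in> B1)})
    = (\<Sum>p\<in>A \<times> B. if R (fst p) (snd p) \<and> (fst p \<in> A1) \<noteq> (snd p \<in> B1) then 1 else 0)"
    using finite_A finite_B by (simp add: sum.inter_filter[symmetric])
  also have "\<dots> = (\<Sum>a\<in>A. \<Sum>b\<in>B. if R a b \<and> (a \<in> A1) \<noteq> (b \<in> B1) then 1 else 0)"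
    by (simp add: sum.cartesian_product split_def)
  \<comment> \<open>The expression i + j - 2 i j is the indicator of exactly one end lying in the
    part.\<close>
  also have "\<dots> = (\<Sum>b\<in>B. \<Sum>a\<in>A. if R a b then ?i a + ?j b - 2 * (?i a * ?j b) else 0)"
    by (subst sum.swap) (intro sum.cong refl, auto simp: indicator_def)
  also have "\<dots> = (\<Sum>b\<in>B. \<Sum>a\<in>{a\<in>A. R a b}. ?i a + ?j b - 2 * (?i a * ?j b))"
    using finite_A by (simp add: sum.inter_filter)
  also have "\<dots> = pairing ?i (\<lambda>_. 1) + pairing (\<lambda>_. 1) ?j - 2 * pairing ?i ?j"
    by (simp add: pairing_def sum.distrib sum_subtractf sum_distrib_left sum_distrib_right mult_ac)
  also have "\<dots> = d * (card A1 + card B1) - 2 * pairing ?i ?j"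
    using assms finite_A finite_B
    by (simp add: pairing_const_left pairing_const_right sum_indicator_subset algebra_simps)
  finally show ?thesis
    using edges_between_bipartite_graph[OF assms] by metis
qed

lemma partition_bipartite:
  assumes "U \<inter> W = {}" "U \<union> W = A <+> B"
  obtains A1 B1 where "A1 \<subseteq> A" "B1 \<subseteq> B" "U = A1 <+> B1" "W = (A - A1) <+> (B - B1)"
proof
  have W: "W = (A <+> B) - U" using assms by auto
  have "U \<subseteq> A <+> B" using assms by auto
  then show "{a. Inl a \<in> U} \<subseteq> A" "{b. Inr b \<in> U} \<subseteq> B" by auto
  show U: "U = {a. Inl a \<in> U} <+> {b. Inr b \<in> U}"
  proof (intro equalityI subsetI)
    fix x assume "x \<in> U" then show "x \<in> {a. Inl a \<in> U} <+> {b. Inr b \<in> U}"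
      by (cases x) auto
  qed auto
  show "W = (A - {a. Inl a \<in> U}) <+> (B - {b. Inr b \<in> U})"
    unfolding W by auto
qed

lemma card_Plus_real:
  assumes "A1 \<subseteq> A" "B1 \<subseteq> B"
  shows "real (card (A1 <+> B1)) = card A1 + card B1"
  using assms finite_A finite_B by (subst card_Plus) (auto intro: finite_subset)

lemma finite_isoperimetric_ratios:
  "finite {real (edges_between (bipartite_graph A B R) U W) / real (min (card U) (card W)) | U W.
      U \<noteq> {} \<and> W \<noteq> {} \<and> U \<inter> W = {} \<and> U \<union> W = fst (bipartite_graph A B R)}" (is "finite ?S")
proof (rule finite_subset)
  let ?P = "Pow (A <+> B)"
  show "?S \<subseteq> (\<lambda>(U, W). real (edges_between (bipartite_graph A B R) U W)
      / real (min (card U) (card W))) ` (?P \<times> ?P)"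
  proof
    fix r assume "r \<in> ?S"
    then obtain U W where r: "r = real (edges_between (bipartite_graph A B R) U W)
        / real (min (card U) (card W))" and "U \<union> W = A <+> B"
      by (auto simp: bipartite_graph_def)
    then have "(U, W) \<in> ?P \<times> ?P" by auto
    then show "r \<in> (\<lambda>(U, W). real (edges_between (bipartite_graph A B R) U W)
        / real (min (card U) (card W))) ` (?P \<times> ?P)"
      by (rule rev_image_eqI) (simp add: r)
  qed
  show "finite ((\<lambda>(U, W). real (edges_between (bipartite_graph A B R) U W)
      / real (min (card U) (card W))) ` (?P \<times> ?P))"
    using finite_A finite_B by simp
qed

text \<open>Edges inside \<open>U\<close> are counted by pairing the centred indicators of its two halves; the
  second singular value bound enters through \<open>2uv \<le> l u\<^sup>2 + v\<^sup>2 / l\<close>.\<close>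

lemma edges_between_lower:
  assumes l: "0 < l" "l \<le> d"
    and gap: "\<And>f. (\<Sum>a\<in>A. f a) = 0 \<Longrightarrow>
        (\<Sum>b\<in>B. (\<Sum>a\<in>{a\<in>A. R a b}. f a)\<^sup>2) \<le> l\<^sup>2 * (\<Sum>a\<in>A. (f a)\<^sup>2)"
    and sub: "A1 \<subseteq> A" "B1 \<subseteq> B" and small: "real (card A1) + real (card B1) \<le> m"
  shows "real (edges_between (bipartite_graph A B R) (A1 <+> B1) ((A - A1) <+> (B - B1)))
      \<ge> (d - l) / 2 * (card A1 + card B1)"
proof -
  define x y where "x = real (card A1)" and "y = real (card B1)"
  define u where "u = (\<lambda>b. indicator B1 b - y / m)"
  define f where "f = (\<lambda>a. indicator A1 a - x / m)"
  define v where "v = (\<lambda>b. \<Sum>a\<in>{a\<in>A. R a b}. f a)"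
  have indA: "(\<Sum>a\<in>A. indicator A1 a) = x"
    using sub finite_A by (simp add: x_def sum_indicator_subset)
  have indB: "(\<Sum>a\<in>B. indicator B1 a) = y"
    using sub finite_B by (simp add: y_def sum_indicator_subset)
  have sq: "(indicator S t)\<^sup>2 = (indicator S t :: real)" for S :: "'z set" and t
    by (simp add: indicator_def)
  have f0: "(\<Sum>a\<in>A. f a) = 0"
    using m_pos by (simp add: f_def sum_subtractf indA card_A)
  have f2: "(\<Sum>a\<in>A. (f a)\<^sup>2) = x - x\<^sup>2 / m"
  proof -
    have "(\<Sum>a\<in>A. (f a)\<^sup>2) = (\<Sum>a\<in>A. indicator A1 a * (1 - 2 * x / m) + (x / m)\<^sup>2)"
      by (intro sum.cong refl) (simp add: f_def power2_diff sq algebra_simps)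
    also have "\<dots> = x * (1 - 2 * x / m) + m * (x / m)\<^sup>2"
      by (simp add: sum.distrib card_A indA flip: sum_distrib_right)
    also have "\<dots> = x - x\<^sup>2 / m"
      using m_pos by (simp add: field_simps power2_eq_square)
    finally show ?thesis .
  qed
  have u2: "(\<Sum>a\<in>B. (u a)\<^sup>2) = y - y\<^sup>2 / m"
  proof -
    have "(\<Sum>a\<in>B. (u a)\<^sup>2) = (\<Sum>a\<in>B. indicator B1 a * (1 - 2 * y / m) + (y / m)\<^sup>2)"
      by (intro sum.cong refl) (simp add: u_def power2_diff sq algebra_simps)
    also have "\<dots> = y * (1 - 2 * y / m) + m * (y / m)\<^sup>2"
      by (simp add: sum.distrib card_B indB flip: sum_distrib_right)
    also have "\<dots> = y - y\<^sup>2 / m"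
      using m_pos by (simp add: field_simps power2_eq_square)
    finally show ?thesis .
  qed
  have "pairing (indicator A1) (indicator B1) = pairing (\<lambda>a. f a + x / m) (\<lambda>b. u b + y / m)"
    by (simp add: f_def u_def)
  \<comment> \<open>The mixed terms vanish because \<open>f\<close> and \<open>u\<close> both have
    sum zero.\<close>
  also have "\<dots> = pairing f u + d * (x / m) * y"
  proof -
    have "(\<Sum>b\<in>B. u b) = 0"
      using m_pos by (simp add: u_def sum_subtractf indB card_B)
    moreover have "pairing (\<lambda>_. x / m) (\<lambda>_. y / m) = d * (x / m) * y"
      using m_pos by (simp add: pairing_const_left card_B)
    ultimately show ?thesis
      by (simp only: pairing_add_left pairing_add_right pairing_const_left pairing_const_right f0)
  qed
  finally have P: "pairing (indicator A1) (indicator B1) = pairing f u + d * (x / m) * y" .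
  have "2 * pairing f u = (\<Sum>b\<in>B. 2 * v b * u b)"
    by (simp add: pairing_def v_def sum_distrib_left mult_ac)
  also have "\<dots> \<le> (\<Sum>b\<in>B. l * (u b)\<^sup>2 + (v b)\<^sup>2 / l)"
  proof (rule sum_mono)
    fix b
    define w where "w = v b / l"
    have v: "v b = l * w" using l by (simp add: w_def)
    have "0 \<le> l * (u b - w)\<^sup>2" using l by simp
    then have "2 * (l * w) * u b \<le> l * (u b)\<^sup>2 + l * w\<^sup>2"
      by (simp add: power2_eq_square algebra_simps)
    moreover have "(l * w)\<^sup>2 / l = l * w\<^sup>2" using l by (simp add: power2_eq_square)
    ultimately show "2 * v b * u b \<le> l * (u b)\<^sup>2 + (v b)\<^sup>2 / l" unfolding v by linarith
  qed
  also have "\<dots> = l * (y - y\<^sup>2 / m) + (\<Sum>b\<in>B. (v b)\<^sup>2) / l"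
    by (simp add: sum.distrib u2 flip: sum_distrib_left sum_divide_distrib)
  also have "\<dots> \<le> l * (y - y\<^sup>2 / m) + l\<^sup>2 * (x - x\<^sup>2 / m) / l"
    using gap[OF f0] l by (simp add: v_def f2 divide_right_mono)
  also have "\<dots> = l * (x + y) - l * (x\<^sup>2 + y\<^sup>2) / m"
    using l m_pos by (simp add: field_simps power2_eq_square)
  finally have fu: "2 * pairing f u \<le> l * (x + y) - l * (x\<^sup>2 + y\<^sup>2) / m" .
  have xy: "x \<ge> 0" "y \<ge> 0" "x + y \<le> m" using small by (auto simp: x_def y_def)
  \<comment> \<open>Rests on 4 d x y - 2 l (x^2 + y^2) = (d - l) (x + y)^2 - (d + l) (x - y)^2. Both
    losses vanish for x = y = m / 2, the shape of the partition in
    \<open>isoperimetric_upper\<close>.\<close>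
  have "(d - l) * (x + y)\<^sup>2 \<le> (d - l) * ((x + y) * m)"
    using l xy by (intro mult_left_mono) (auto simp: power2_eq_square intro: mult_left_mono)
  moreover have "0 \<le> (d + l) * (x - y)\<^sup>2" using l by simp
  ultimately have "4 * d * x * y - 2 * l * (x\<^sup>2 + y\<^sup>2) \<le> (d - l) * (x + y) * m"
    by (simp add: power2_eq_square algebra_simps)
  then have "(4 * d * x * y - 2 * l * (x\<^sup>2 + y\<^sup>2)) / m \<le> (d - l) * (x + y)"
    using m_pos by (simp add: pos_divide_le_eq)
  then have "2 * (d * (x / m) * y) - l * (x\<^sup>2 + y\<^sup>2) / m \<le> (d - l) / 2 * (x + y)"
    using m_pos by (simp add: field_simps)
  with fu have "(d - l) / 2 * (x + y) \<le> d * (x + y) - 2 * pairing (indicator A1) (indicator B1)"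
    unfolding P by argo
  then show ?thesis
    by (simp add: edges_between_eq_pairing[OF sub] x_def y_def)
qed

theorem isoperimetric_lower:
  assumes l: "0 < l" "l \<le> d"
    and gap: "\<And>f. (\<Sum>a\<in>A. f a) = 0 \<Longrightarrow>
        (\<Sum>b\<in>B. (\<Sum>a\<in>{a\<in>A. R a b}. f a)\<^sup>2) \<le> l\<^sup>2 * (\<Sum>a\<in>A. (f a)\<^sup>2)"
  shows "isoperimetric (bipartite_graph A B R) \<ge> (d - l) / 2"
proof -
  let ?S = "{real (edges_between (bipartite_graph A B R) U W) / real (min (card U) (card W)) | U W.
      U \<noteq> {} \<and> W \<noteq> {} \<and> U \<inter> W = {} \<and> U \<union> W = fst (bipartite_graph A B R)}"
  have "A \<noteq> {}" "B \<noteq> {}"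
    using card_A card_B m_pos by (metis card.empty of_nat_0 less_irrefl)+
  \<comment> \<open>The cut into the two sides of the graph shows that the minimum is over a
    nonempty set.\<close>
  define U :: "('v + 'w) set" where "U = Inl ` A"
  define W :: "('v + 'w) set" where "W = Inr ` B"
  have "U \<noteq> {}" "W \<noteq> {}" "U \<inter> W = {}" "U \<union> W = fst (bipartite_graph A B R)"
    using \<open>A \<noteq> {}\<close> \<open>B \<noteq> {}\<close> by (auto simp: bipartite_graph_def U_def W_def)
  then have "real (edges_between (bipartite_graph A B R) U W) / real (min (card U) (card W)) \<in> ?S"
    by (intro CollectI exI[of _ U] exI[of _ W] conjI refl)
  then have ne: "?S \<noteq> {}"
    by (metis empty_iff)
  have "(d - l) / 2 \<le> r" if "r \<in> ?S" for r
  proof -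
    from that
    obtain U W where r: "r = real (edges_between (bipartite_graph A B R) U W)
        / real (min (card U) (card W))" and UW: "U \<noteq> {}" "W \<noteq> {}" "U \<inter> W = {}" "U \<union> W = A <+> B"
      by (auto simp: bipartite_graph_def)
    obtain A1 B1 where AB: "A1 \<subseteq> A" "B1 \<subseteq> B" "U = A1 <+> B1" "W = (A - A1) <+> (B - B1)"
      using partition_bipartite[OF UW(3,4)] .
    have fin: "finite A1" "finite B1" using AB finite_A finite_B finite_subset by auto
    have cU: "real (card U) = card A1 + card B1" using AB by (simp add: card_Plus_real)
    have cW: "real (card W) = card (A - A1) + card (B - B1)" using AB by (simp add: card_Plus_real)
    have cA: "real (card (A - A1)) = m - card A1" "real (card (B - B1)) = m - card B1"
      using AB fin finite_A finite_B card_A card_B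
      by (auto simp: card_Diff_subset card_mono of_nat_diff)
    have pos: "0 < real (min (card U) (card W))"
    proof -
      have "finite U" "finite W" using UW(4) finite_A finite_B
        by (metis finite_Plus finite_Un)+
      then show ?thesis using UW by (simp add: card_gt_0_iff)
    qed
    have "(d - l) / 2 * min (card U) (card W) \<le> edges_between (bipartite_graph A B R) U W"
    proof (cases "real (card A1) + real (card B1) \<le> m")
      case True
      have "real (card U) \<le> card W" using True cU cW cA by simp
      then show ?thesis
        using edges_between_lower[OF l gap AB(1,2) True] cU
        by (simp add: AB(3,4) min_def)
    next
      case False
      \<comment> \<open>The complement is now the smaller part; it has the same crossing
        edges.\<close>
      have sub: "A - A1 \<subseteq> A" "B - B1 \<subseteq> B" by auto
      have "A - (A - A1) = A1" "B - (B - B1) = B1" using AB by auto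
      moreover have "real (card (A - A1)) + real (card (B - B1)) \<le> m" using False cA by simp
      moreover have "real (card W) \<le> card U" using False cU cW cA by simp
      ultimately show ?thesis
        using edges_between_lower[OF l gap sub] cW
        by (subst edges_between_commute) (simp add: AB(3,4) min_def)
    qed
    then show "(d - l) / 2 \<le> r"
      using pos unfolding r by (simp add: pos_le_divide_eq)
  qed
  then show ?thesis
    unfolding isoperimetric_def by (rule Min.boundedI[OF finite_isoperimetric_ratios ne])
qed

text \<open>The part \<open>A1 <+> B1\<close> takes the +1 class on each side. Each class has size m
  / 2 because the signs sum to zero, so both parts of the cut have m vertices.\<close>

theorem isoperimetric_upper:
  assumes eta: "\<And>a. a \<in> A \<Longrightarrow> \<eta> a \<in> {1, -1::real}" and eps: "\<And>b. b \<in> B \<Longrightarrow> \<epsilon> b \<in> {1, -1::real}"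
    and eta0: "(\<Sum>a\<in>A. \<eta> a) = 0" and eps0: "(\<Sum>b\<in>B. \<epsilon> b) = 0"
    and sv: "\<And>b. b \<in> B \<Longrightarrow> (\<Sum>a\<in>{a\<in>A. R a b}. \<eta> a) = l * \<epsilon> b"
  shows "isoperimetric (bipartite_graph A B R) \<le> (d - l) / 2"
proof -
  define A1 B1 where "A1 = {a\<in>A. \<eta> a = 1}" and "B1 = {b\<in>B. \<epsilon> b = 1}"
  have sub: "A1 \<subseteq> A" "B1 \<subseteq> B" by (auto simp: A1_def B1_def)
  have iA: "indicator A1 a = (\<eta> a + 1) / 2" if "a \<in> A" for a
    using eta[OF that] that by (auto simp: A1_def indicator_def)
  have iB: "indicator B1 b = (\<epsilon> b + 1) / 2" if "b \<in> B" for b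
    using eps[OF that] that by (auto simp: B1_def indicator_def)
  have "real (card A1) = (\<Sum>a\<in>A. indicator A1 a)"
    using sub finite_A by (simp add: sum_indicator_subset)
  also have "\<dots> = (\<Sum>a\<in>A. (\<eta> a + 1) / 2)" by (intro sum.cong refl iA)
  also have "\<dots> = m / 2" using eta0 by (simp add: sum.distrib card_A flip: sum_divide_distrib)
  finally have cA: "real (card A1) = m / 2" .
  have "real (card B1) = (\<Sum>a\<in>B. indicator B1 a)"
    using sub finite_B by (simp add: sum_indicator_subset)
  also have "\<dots> = (\<Sum>a\<in>B. (\<epsilon> a + 1) / 2)" by (intro sum.cong refl iB)
  also have "\<dots> = m / 2" using eps0 by (simp add: sum.distrib card_B flip: sum_divide_distrib)
  finally have cB: "real (card B1) = m / 2" .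
  have "pairing (indicator A1) (indicator B1) = (\<Sum>b\<in>B. (l * \<epsilon> b + d) / 2 * ((\<epsilon> b + 1) / 2))"
    unfolding pairing_def
  proof (intro sum.cong refl arg_cong2[of _ _ _ _ "(*)"])
    fix b assume b: "b \<in> B"
    have "(\<Sum>a\<in>{a\<in>A. R a b}. indicator A1 a) = (\<Sum>a\<in>{a\<in>A. R a b}. (\<eta> a + 1) / 2)"
      by (intro sum.cong refl iA) auto
    also have "\<dots> = (l * \<epsilon> b + d) / 2"
      using sv[OF b] degree_B[OF b] by (simp add: sum.distrib flip: sum_divide_distrib)
    finally show "(\<Sum>a\<in>{a\<in>A. R a b}. indicator A1 a) = (l * \<epsilon> b + d) / 2" .
    show "indicator B1 b = (\<epsilon> b + 1) / 2" using iB[OF b] .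
  qed
  \<comment> \<open>Since \<open>\<epsilon> b\<close> squares to 1, the product is affine in
    \<open>\<epsilon> b\<close>; its linear part then sums to zero.\<close>
  also have "\<dots> = (\<Sum>b\<in>B. (l + d) / 4 + (l + d) / 4 * \<epsilon> b)"
  proof (intro sum.cong refl)
    fix b assume "b \<in> B"
    then show "(l * \<epsilon> b + d) / 2 * ((\<epsilon> b + 1) / 2) = (l + d) / 4 + (l + d) / 4 * \<epsilon> b"
      using eps[of b] by (auto simp: field_simps)
  qed
  also have "\<dots> = m * ((l + d) / 4)"
    by (simp only: sum.distrib sum_distrib_left[symmetric] eps0 sum_constant card_B)
  finally have P: "pairing (indicator A1) (indicator B1) = m * ((l + d) / 4)" .
  define U W where "U = A1 <+> B1" and "W = (A - A1) <+> (B - B1)"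
  have e: "real (edges_between (bipartite_graph A B R) U W) = (d - l) / 2 * m"
    unfolding U_def W_def edges_between_eq_pairing[OF sub] P by (simp add: cA cB field_simps)
  have fin: "finite A1" "finite B1" using sub finite_A finite_B finite_subset by auto
  have cU: "real (card U) = m" unfolding U_def using sub cA cB by (simp add: card_Plus_real)
  have cA': "real (card (A - A1)) = m - card A1" "real (card (B - B1)) = m - card B1"
    using sub fin finite_A finite_B card_A card_B
    by (auto simp: card_Diff_subset card_mono of_nat_diff)
  have cW: "real (card W) = m" unfolding W_def using cA' cA cB by (simp add: card_Plus_real)
  have ne: "U \<noteq> {}" "W \<noteq> {}"
    using cU cW m_pos by (metis card.empty of_nat_0 less_irrefl)+
  have disj: "U \<inter> W = {}" "U \<union> W = fst (bipartite_graph A B R)"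
    using sub by (auto simp: U_def W_def bipartite_graph_def)
  have "real (min (card U) (card W)) = m" using cU cW by (simp add: min_def)
  then have "(d - l) / 2
      = real (edges_between (bipartite_graph A B R) U W) / real (min (card U) (card W))"
    using e m_pos by simp
  then show ?thesis
    unfolding isoperimetric_def using ne disj
    by (intro Min_le[OF finite_isoperimetric_ratios] CollectI exI conjI)
qed

text \<open>Joining the +1 class on one side with the -1 class on the other replaces
  \<open>s\<close> by \<open>- s\<close>, so the better of the two cuts gets the absolute
  value.\<close>

corollary isoperimetric_upper_abs:
  assumes eta: "\<And>a. a \<in> A \<Longrightarrow> \<eta> a \<in> {1, -1::real}" and eps: "\<And>b. b \<in> B \<Longrightarrow> \<epsilon> b \<in> {1, -1::real}"
    and eta0: "(\<Sum>a\<in>A. \<eta> a) = 0" and eps0: "(\<Sum>b\<in>B. \<epsilon> b) = 0"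
    and sv: "\<And>b. b \<in> B \<Longrightarrow> (\<Sum>a\<in>{a\<in>A. R a b}. \<eta> a) = s * \<epsilon> b"
  shows "isoperimetric (bipartite_graph A B R) \<le> (d - \<bar>s\<bar>) / 2"
proof (cases "s \<ge> 0")
  case True
  then show ?thesis using isoperimetric_upper[OF eta eps eta0 eps0 sv] by simp
next
  case False
  have "isoperimetric (bipartite_graph A B R) \<le> (d - (- s)) / 2"
  proof (rule isoperimetric_upper[OF eta _ eta0])
    show "- \<epsilon> b \<in> {1, - 1}" if "b \<in> B" for b using eps[OF that] by auto
    show "(\<Sum>b\<in>B. - \<epsilon> b) = 0" using eps0 by (simp add: sum_negf)
    show "(\<Sum>a\<in>{a\<in>A. R a b}. \<eta> a) = - s * - \<epsilon> b" if "b \<in> B" for b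
      using sv[OF that] by simp
  qed
  then show ?thesis using False by simp
qed

end

section \<open>Finite extensions of finite fields\<close>

text \<open>Multiplication by \<open>x\<close> permutes the nonzero elements, so the factor
  \<open>x ^ (CARD('a) - 1)\<close> leaves their product unchanged.\<close>

lemma finite_field_power_card_minus_1:
  fixes x :: "'a::{field,finite}"
  assumes "x \<noteq> 0"
  shows "x ^ (CARD('a) - 1) = 1"
proof -
  have "(\<Prod>y\<in>UNIV-{0}. x * y) = (\<Prod>y\<in>UNIV-{0}. y)"
    using assms
    by (intro prod.reindex_bij_witness[of _ "\<lambda>y. y / x" "\<lambda>y. x * y"]) auto
  then have "x ^ (CARD('a) - 1) * (\<Prod>y\<in>UNIV-{0}. y) = 1 * (\<Prod>y\<in>UNIV-{0::'a}. y)"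
    by (simp add: prod.distrib card_Diff_singleton)
  moreover have "(\<Prod>y\<in>UNIV-{0::'a}. y) \<noteq> 0" by simp
  ultimately show ?thesis by (metis mult_right_cancel)
qed

lemma finite_field_power_card:
  fixes x :: "'a::{field,finite}"
  shows "x ^ CARD('a) = x"
proof (cases "x = 0")
  case False
  have "x ^ CARD('a) = x * x ^ (CARD('a) - 1)"
    by (metis One_nat_def Suc_pred power_Suc zero_less_card_finite)
  then show ?thesis using finite_field_power_card_minus_1[OF False] by simp
qed simp

lemma finite_field_power_card_power:
  fixes x :: "'a::{field,finite}"
  shows "x ^ (CARD('a) ^ k) = x"
  by (induction k) (simp_all add: finite_field_power_card power_mult)

lemma CARD_field_ge_2: "CARD('a::{field,finite}) \<ge> 2"
proof -
  have "card {0, 1::'a} \<le> CARD('a)" by (rule card_mono) auto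
  then show ?thesis by simp
qed

text \<open>\<open>(x + 1)\<^sup>q - x\<^sup>q - 1\<close> has degree below \<open>q\<close> but vanishes on all \<open>q\<close> elements.\<close>

lemma of_nat_card_choose_eq_0:
  assumes "0 < i" "i < CARD('a::{field,finite})"
  shows "(of_nat (CARD('a) choose i) :: 'a) = 0"
proof -
  let ?q = "CARD('a)"
  define p :: "'a poly" where "p = [:1, 1:] ^ ?q - Polynomial.monom 1 ?q - 1"
  have lin: "Polynomial.coeff ([:1, 1:] ^ ?q) j = (of_nat (?q choose j) :: 'a)" for j
  proof (cases "j \<le> ?q")
    case True then show ?thesis by (simp add: coeff_linear_poly_power)
  next
    case False
    then have "Polynomial.degree ([:1, 1::'a:] ^ ?q) < j"
      using degree_power_le[of "[:1, 1::'a:]" ?q] by simp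
    then show ?thesis using False by (simp add: coeff_eq_0 binomial_eq_0)
  qed
  have q: "?q \<ge> 2" by (rule CARD_field_ge_2)
  have "Polynomial.coeff p j = 0" if "j \<ge> ?q" for j
    using that q by (auto simp: p_def lin binomial_eq_0)
  then have deg: "Polynomial.degree p < ?q"
    using q by (metis coeff_0 leading_coeff_0_iff degree_0 less_le_trans not_le zero_less_numeral)
  have "poly p x = 0" for x
    by (simp add: p_def poly_monom finite_field_power_card)
  then have "card {x. poly p x = 0} = ?q" by simp
  then have "p = 0" using card_poly_roots_bound[of p] deg by linarith
  then have "Polynomial.coeff p i = 0" by simp
  then show ?thesis using assms by (simp add: p_def lin)
qed

text \<open>The middle binomial coefficients vanish in the base field, and \<open>to_ac\<close>
  carries this to the closure. Additivity will make the fixed points of the power map a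
  subspace.\<close>

lemma frobenius_add:
  fixes x y :: "'a::{field,finite} alg_closure"
  shows "(x + y) ^ CARD('a) = x ^ CARD('a) + y ^ CARD('a)"
proof -
  let ?q = "CARD('a)"
  let ?t = "\<lambda>k. of_nat (?q choose k) * x ^ k * y ^ (?q - k)"
  have q: "?q \<ge> 2" by (rule CARD_field_ge_2)
  have "?t k = 0" if "k \<in> {..?q} - {0, ?q}" for k
  proof -
    have "(of_nat (?q choose k) :: 'a) = 0"
      using that by (intro of_nat_card_choose_eq_0) auto
    then have "(of_nat (?q choose k) :: 'a alg_closure) = 0"
      by (metis to_ac_0 to_ac_of_nat)
    then show ?thesis by simp
  qed
  then have "(\<Sum>k\<le>?q. ?t k) = (\<Sum>k\<in>{0, ?q}. ?t k)"
    by (intro sum.mono_neutral_right) auto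
  also have "\<dots> = x ^ ?q + y ^ ?q" using q by simp
  finally show ?thesis by (simp add: binomial_ring)
qed

lemma frobenius_power_add:
  fixes x y :: "'a::{field,finite} alg_closure"
  shows "(x + y) ^ (CARD('a) ^ k) = x ^ (CARD('a) ^ k) + y ^ (CARD('a) ^ k)"
proof (induction k)
  case (Suc k)
  have *: "z ^ (CARD('a) ^ Suc k) = (z ^ (CARD('a) ^ k)) ^ CARD('a)" for z :: "'a alg_closure"
    by (simp add: mult.commute flip: power_mult)
  show ?case unfolding * Suc.IH by (rule frobenius_add)
qed simp

text \<open>The polynomial splits into linear factors; a root occurring twice in the multiset
  \<open>S\<close> would also be a root of the derivative.\<close>

lemma card_roots_alg_closed_field:
  fixes p :: "'a::alg_closed_field poly"
  assumes "p \<noteq> 0" and simple: "\<And>x. poly p x = 0 \<Longrightarrow> poly (pderiv p) x \<noteq> 0"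
  shows "card {x. poly p x = 0} = Polynomial.degree p"
proof -
  obtain S where S: "size S = Polynomial.degree p" "p = Polynomial.smult (Polynomial.lead_coeff p) (\<Prod>x\<in>#S. [:-x, 1:])"
    using alg_closed_imp_factorization[OF assms(1)] by blast
  have "count S x = 1" if x: "x \<in># S" for x
  proof (rule ccontr)
    assume "count S x \<noteq> 1"
    obtain S' where S': "S = add_mset x S'" using x by (metis multi_member_split)
    then have "x \<in># S'" using \<open>count S x \<noteq> 1\<close> by (simp add: count_eq_zero_iff)
    then obtain S'' where S'': "S' = add_mset x S''" by (metis multi_member_split)
    define r where "r = Polynomial.smult (Polynomial.lead_coeff p) (\<Prod>x\<in>#S''. [:-x, 1:])"
    have p: "p = [:-x, 1:] * ([:-x, 1:] * r)"
      by (subst S(2)) (simp only: r_def S' S'' image_mset_add_mset prod_mset.add_mset mult_smult_right)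
    have "poly p x = 0" by (subst p) simp
    moreover have "poly (pderiv p) x = 0" by (subst p) (simp only: pderiv_mult poly_add poly_mult, simp)
    ultimately show False using simple by blast
  qed
  then have "size S = card (set_mset S)"
    by (simp add: size_multiset_overloaded_eq)
  moreover have "{x. poly p x = 0} = set_mset S"
  proof -
    have "poly p x = 0 \<longleftrightarrow> x \<in># S" for x
    proof -
      have "poly p x = Polynomial.lead_coeff p * (\<Prod>y\<in>#S. x - y)"
        by (subst S(2)) (simp add: poly_prod_mset image_mset.compositionality comp_def)
      then show ?thesis using assms(1) by (auto simp: prod_mset_zero_iff)
    qed
    then show ?thesis by auto
  qed
  ultimately show ?thesis using S(1) by simp
qed

text \<open>The fixed points are the roots of X^Q - X, whose derivative is the constant -1 because Q
  vanishes in the field.\<close>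

lemma card_frobenius_fixed:
  assumes "n > 0"
  shows "card {x :: 'a::{field,finite} alg_closure. x ^ (CARD('a) ^ n) = x} = CARD('a) ^ n"
proof -
  let ?Q = "CARD('a) ^ n"
  define p :: "'a alg_closure poly" where "p = Polynomial.monom 1 ?Q - Polynomial.monom 1 1"
  have q: "CARD('a) \<ge> 2" by (rule CARD_field_ge_2)
  have Q: "?Q > 1" using q assms by (intro one_less_power) auto
  have "Polynomial.degree p = ?Q"
  proof (rule antisym)
    show "Polynomial.degree p \<le> ?Q"
      unfolding p_def using Q by (intro degree_diff_le) (auto simp: degree_monom_eq)
    show "?Q \<le> Polynomial.degree p"
      using Q by (intro le_degree) (simp add: p_def)
  qed
  \<comment> \<open>The binomial coefficient at index 1 is \<open>CARD('a)\<close> itself.\<close>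
  have q0: "(of_nat CARD('a) :: 'a alg_closure) = 0"
    using of_nat_card_choose_eq_0[where 'a='a, of 1] q
    by (metis One_nat_def Suc_1 Suc_le_lessD choose_one lessI to_ac_0 to_ac_of_nat)
  have Q0: "(of_nat ?Q :: 'a alg_closure) = 0"
    using assms by (simp only: of_nat_power q0) simp
  have "pderiv p = - 1"
    unfolding p_def pderiv_diff pderiv_monom by (simp only: Q0) (simp add: monom_0 one_pCons)
  then have "poly (pderiv p) x \<noteq> 0" for x by simp
  moreover have "p \<noteq> 0" using \<open>Polynomial.degree p = ?Q\<close> Q by auto
  ultimately have "card {x. poly p x = 0} = ?Q"
    using card_roots_alg_closed_field[of p] \<open>Polynomial.degree p = ?Q\<close> by simp
  moreover have "{x. poly p x = 0} = {x. x ^ ?Q = x}"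
    by (auto simp: p_def poly_monom)
  ultimately show ?thesis by simp
qed


section \<open>Coordinates on the extension of degree n\<close>

lemma vector_space_alg_closure: "vector_space (\<lambda>c (x :: 'a::field alg_closure). to_ac c * x)"
  by unfold_locales (simp_all add: algebra_simps)

text \<open>Coordinates with respect to \<open>S\<close> match the elements of \<open>V\<close> with
  the functions from \<open>S\<close> to the scalars. This recovers the dimension of the extension
  from its cardinality.\<close>

lemma card_eq_card_basis:
  fixes V :: "'v::ab_group_add set" and scale :: "'a::{field,finite} \<Rightarrow> 'v \<Rightarrow> 'v"
  assumes "vector_space scale" and "finite S" and "\<not> module.dependent scale S"
    and "module.span scale S = V"
  shows "card V = CARD('a) ^ card S"
proof -
  interpret vector_space scale by fact
  let ?f = "\<lambda>u. \<Sum>v\<in>S. scale (u v) v"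
  have inj: "inj_on ?f (S \<rightarrow>\<^sub>E UNIV)"
  proof (rule inj_onI)
    fix u w assume uw: "u \<in> S \<rightarrow>\<^sub>E UNIV" "w \<in> S \<rightarrow>\<^sub>E UNIV" "?f u = ?f w"
    then have "(\<Sum>v\<in>S. scale (u v - w v) v) = 0"
      by (simp add: scale_left_diff_distrib sum_subtractf)
    then have "u v - w v = 0" if "v \<in> S" for v
      using independentD[OF assms(3,2) order_refl, where u = "\<lambda>v. u v - w v"] that by simp
    then show "u = w" using uw(1,2) by (intro PiE_ext[of _ S "\<lambda>_. UNIV"]) auto
  qed
  have im: "?f ` (S \<rightarrow>\<^sub>E UNIV) = V"
  proof -
    have "?f ` (S \<rightarrow>\<^sub>E UNIV) = range ?f"
    proof (intro equalityI subsetI)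
      fix x assume "x \<in> range ?f"
      then obtain u where u: "x = ?f u" by blast
      have "?f u = ?f (restrict u S)" by (intro sum.cong) auto
      then show "x \<in> ?f ` (S \<rightarrow>\<^sub>E UNIV)" using u by (intro image_eqI[of _ _ "restrict u S"]) auto
    qed auto
    also have "\<dots> = V" using span_finite[OF assms(2)] assms(4) by simp
    finally show ?thesis .
  qed
  have "card V = card (S \<rightarrow>\<^sub>E (UNIV :: 'a set))"
    using card_image[OF inj] unfolding im .
  then show ?thesis using assms(2) by (simp add: card_PiE)
qed

text \<open>A copy \<open>K\<close> of the extension of degree \<open>n\<close> of the field \<open>'a\<close>, in coordinates \<open>\<phi>\<close>.\<close>

locale extension_model =
  fixes K :: "'k::field set" and \<iota> :: "'a::{field,finite} \<Rightarrow> 'k" and \<phi> :: "'a ^ 'n::finite \<Rightarrow> 'k"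
    and q n :: nat
  assumes q_eq: "q = CARD('a)" and n_eq: "n = CARD('n)"
    and bij: "bij_betw \<phi> UNIV K"
    and phi_add: "\<phi> (a + b) = \<phi> a + \<phi> b"
    and phi_scale: "\<phi> (c *s a) = \<iota> c * \<phi> a"
    and one_K: "1 \<in> K"
    and mult_K: "x \<in> K \<Longrightarrow> y \<in> K \<Longrightarrow> x * y \<in> K"
    and iota_K: "\<iota> c \<in> K"
    and iota_mult: "\<iota> (c * c') = \<iota> c * \<iota> c'"
    and iota_0_iff: "\<iota> c = 0 \<longleftrightarrow> c = 0"
    and iota_1_iff: "\<iota> c = 1 \<longleftrightarrow> c = 1"
    and frobenius_K: "x \<in> K \<Longrightarrow> x ^ (q ^ n) = x"

text \<open>The degree is the cardinality of a type variable, so the extension is taken as a set and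
  not as a type: the fixed points of x -> x^(q^n) in the algebraic closure. Frobenius additivity
  makes it a subspace, and its size q^n forces dimension n.\<close>

lemma extension_model_exists:
  "\<exists>K (\<phi> :: 'a::{field,finite} ^ 'n::finite \<Rightarrow> 'a alg_closure). extension_model K to_ac \<phi> CARD('a) CARD('n)"
proof -
  let ?Q = "CARD('a) ^ CARD('n)"
  define K where "K = {x :: 'a alg_closure. x ^ ?Q = x}"
  interpret vector_space "\<lambda>c (x :: 'a alg_closure). to_ac c * x"
    by (rule vector_space_alg_closure)
  have toK: "to_ac c \<in> K" for c :: 'a
    by (simp add: K_def finite_field_power_card_power flip: to_ac_power)
  have multK: "x * y \<in> K" if "x \<in> K" "y \<in> K" for x y
    using that by (simp add: K_def power_mult_distrib)
  have addK: "x + y \<in> K" if "x \<in> K" "y \<in> K" for x y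
    using that by (simp add: K_def frobenius_power_add)
  have sub: "subspace K"
    using toK[of 0] by (intro subspaceI addK multK toK) simp_all
  have cK: "card K = ?Q"
    unfolding K_def by (rule card_frobenius_fixed) simp
  then have finK: "finite K" by (intro card_ge_0_finite) simp
  obtain S where S: "S \<subseteq> K" "independent S" "K \<subseteq> span S"
    using basis_exists[of K] by metis
  have finS: "finite S" using S(1) finK finite_subset by blast
  have spanS: "span S = K" using span_subspace[OF S(1,3) sub] .
  have "?Q = CARD('a) ^ card S"
    using card_eq_card_basis[OF vector_space_alg_closure finS S(2) spanS] cK by simp
  then have "card S = CARD('n)"
    using CARD_field_ge_2[where 'a='a] by (simp add: power_inject_exp)
  \<comment> \<open>Indexing the basis by \<open>'n\<close> itself makes coordinate tuples elements
    of \<open>'a ^ 'n\<close>.\<close>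
  then obtain e where e: "bij_betw e (UNIV :: 'n set) S"
    using finS by (metis finite_class.finite_UNIV finite_same_card_bij)
  define \<phi> :: "'a ^ 'n \<Rightarrow> 'a alg_closure" where "\<phi> = (\<lambda>a. \<Sum>i\<in>UNIV. to_ac (a $ i) * e i)"
  have phiK: "\<phi> a \<in> K" for a
  proof -
    have "e i \<in> K" for i using e S(1) by (auto simp: bij_betw_def)
    then show ?thesis
      unfolding \<phi>_def by (intro subspace_sum[OF sub] multK toK)
  qed
  have phi_surj: "x \<in> range \<phi>" if "x \<in> K" for x
  proof -
    have "x \<in> range (\<lambda>u. \<Sum>v\<in>S. to_ac (u v) * v)"
      using that span_finite[OF finS] spanS by simp
    then obtain u where "x = (\<Sum>v\<in>S. to_ac (u v) * v)" by blast
    also have "\<dots> = (\<Sum>i\<in>UNIV. to_ac (u (e i)) * e i)"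
      by (rule sum.reindex_bij_betw[OF e, symmetric])
    also have "\<dots> = \<phi> (\<chi> i. u (e i))" by (simp add: \<phi>_def)
    finally show ?thesis by blast
  qed
  have im: "\<phi> ` UNIV = K" using phiK phi_surj by blast
  moreover have "inj_on \<phi> UNIV"
    by (rule eq_card_imp_inj_on) (simp_all add: im cK)
  ultimately have bij: "bij_betw \<phi> UNIV K" by (simp add: bij_betw_def)
  have "extension_model K to_ac \<phi> CARD('a) CARD('n)"
  proof
    show "bij_betw \<phi> UNIV K" by (rule bij)
    show "\<phi> (a + b) = \<phi> a + \<phi> b" for a b
      by (simp add: \<phi>_def sum.distrib algebra_simps)
    show "\<phi> (c *s a) = to_ac c * \<phi> a" for c a
      by (simp add: \<phi>_def sum_distrib_left mult_ac)
    show "1 \<in> K" using toK[of 1] by simp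
    show "x ^ (CARD('a) ^ CARD('n)) = x" if "x \<in> K" for x using that by (simp add: K_def)
  qed (simp_all add: multK toK)
  then show ?thesis by blast
qed

section \<open>Sign vectors from the quadratic character\<close>

lemma dot_commute: "dot a b = dot b a"
  by (simp add: dot_def mult.commute)

lemma dot_scale_left: "dot (c *s a) b = c * dot a b"
  by (simp add: dot_def sum_distrib_left mult_ac)

lemma dot_add_right: "dot a (b + b') = dot a b + dot a b'"
  by (simp add: dot_def sum.distrib algebra_simps)

lemma dot_diff_right: "dot a (b - b') = dot a b - dot a b'"
  by (simp add: dot_def sum_subtractf algebra_simps)

lemma dot_axis: "dot a (axis i t) = a $ i * t"
proof -
  have "dot a (axis i t) = (\<Sum>j\<in>UNIV. if j = i then a $ i * t else 0)"
    unfolding dot_def axis_def by (intro sum.cong) auto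
  then show ?thesis by simp
qed

lemma card_roots_of_unity_le:
  assumes "k > 0"
  shows "card {x :: 'f::field. x ^ k = 1} \<le> k"
proof -
  let ?p = "Polynomial.monom 1 k - 1 :: 'f poly"
  have "Polynomial.coeff ?p k = 1" using assms by simp
  then have "?p \<noteq> 0" by (metis coeff_0 zero_neq_one)
  moreover have "Polynomial.degree ?p \<le> k"
    by (intro degree_diff_le) (auto simp: degree_monom_le)
  ultimately have "card {x. poly ?p x = 0} \<le> k"
    using card_poly_roots_bound[of ?p] by linarith
  then show ?thesis by (simp add: poly_monom)
qed

lemma finite_roots_of_unity: "k > 0 \<Longrightarrow> finite {x :: 'f::field. x ^ k = 1}"
proof -
  assume k: "k > 0"
  let ?p = "Polynomial.monom 1 k - 1 :: 'f poly"
  have "Polynomial.coeff ?p k = 1" using k by simp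
  then have "?p \<noteq> 0" by (metis coeff_0 zero_neq_one)
  then have "finite {x. poly ?p x = 0}" by (rule poly_roots_finite)
  then show ?thesis by (simp add: poly_monom)
qed

lemma linear_functional_eq_dot:
  fixes g :: "'a::field ^ 'n::finite \<Rightarrow> 'a"
  assumes add: "\<And>a b. g (a + b) = g a + g b" and scale: "\<And>c a. g (c *s a) = c * g a"
  shows "g a = dot a (\<chi> i. g (axis i 1))"
proof -
  have g0: "g 0 = 0" using scale[of 0 0] by simp
  have sum: "g (\<Sum>i\<in>S. v i) = (\<Sum>i\<in>S. g (v i))" for S :: "'n set" and v
    by (induction S rule: infinite_finite_induct) (simp_all add: g0 add)
  have "g a = g (\<Sum>i\<in>UNIV. a $ i *s axis i 1)" by (simp add: basis_expansion)
  then show ?thesis by (simp add: sum scale dot_def)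
qed

text \<open>The interface to the graphs, free of the extension field. In the model, \<open>h\<close>
  and \<open>h'\<close> are the quadratic character in two different coordinate systems,
  \<open>s t\<close> is its sum over the elements with functional value \<open>t\<close>, and
  \<open>\<kappa>\<close> is its restriction to the nonzero scalars.\<close>

locale sign_vectors =
  fixes h h' :: "'a::{field,finite} ^ 'n::finite \<Rightarrow> real" and s \<kappa> :: "'a \<Rightarrow> real"
  assumes h: "h a \<in> {1, -1}" and h': "h' a \<in> {1, -1}"
    and sum_h: "(\<Sum>a\<in>UNIV - {0}. h a) = 0" and sum_h': "(\<Sum>a\<in>UNIV - {0}. h' a) = 0"
    and sum_hyperplane: "b \<noteq> 0 \<Longrightarrow> (\<Sum>a\<in>{a \<in> UNIV - {0}. dot a b = t}. h a) = s t * h' b"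
    and h_scale: "c \<noteq> 0 \<Longrightarrow> a \<noteq> 0 \<Longrightarrow> h (c *s a) = \<kappa> c * h a"
    and h'_scale: "c \<noteq> 0 \<Longrightarrow> a \<noteq> 0 \<Longrightarrow> h' (c *s a) = \<kappa> c * h' a"
    and kappa_even: "even CARD('n) \<Longrightarrow> c \<noteq> 0 \<Longrightarrow> \<kappa> c = 1"
    and kappa_odd: "odd CARD('n) \<Longrightarrow> (\<Sum>c\<in>UNIV - {0}. \<kappa> c) = 0"

section \<open>The quadratic character of the extension field\<close>

context extension_model
begin

lemma q_ge_2: "q \<ge> 2"
  unfolding q_eq by (rule CARD_field_ge_2)

lemma q_pos: "q > 0"
  using q_ge_2 by simp

lemma n_pos: "n > 0"
  by (simp add: n_eq)

lemma power_q_power: "c ^ (q ^ k) = (c :: 'a)"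
  unfolding q_eq by (rule finite_field_power_card_power)

lemma power_q_power_minus_1:
  assumes "c \<noteq> (0 :: 'a)"
  shows "c ^ (q ^ k - 1) = 1"
proof -
  have "q ^ k > 0" using q_ge_2 by simp
  then have "c * c ^ (q ^ k - 1) = c ^ (q ^ k)"
    by (metis One_nat_def Suc_pred power_Suc)
  then have "c * c ^ (q ^ k - 1) = c * 1" by (simp add: power_q_power)
  then show ?thesis using assms by (metis mult_left_cancel)
qed

text \<open>In q^(2k) - 1 = (q^k - 1) (q^k + 1) the second factor is even and absorbs the division
  by 2, while the first exponent alone already sends \<open>c\<close> to 1. So scalars become
  squares in an extension of even degree.\<close>

lemma power_half_even:
  assumes "odd q" "c \<noteq> (0 :: 'a)"
  shows "c ^ ((q ^ (2 * k) - 1) div 2) = 1"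
proof -
  have "q ^ (2 * k) - 1 = (q ^ k - 1) * (q ^ k + 1)"
    by (simp add: algebra_simps power_add mult_2_right)
  moreover have "even (q ^ k + 1)" using assms(1) by simp
  ultimately have "(q ^ (2 * k) - 1) div 2 = (q ^ k - 1) * ((q ^ k + 1) div 2)"
    by (metis div_mult_swap)
  then show ?thesis using power_q_power_minus_1[OF assms(2)] by (simp add: power_mult)
qed

lemma iota_power: "\<iota> c ^ k = \<iota> (c ^ k)"
  by (induction k) (simp_all add: iota_mult iota_1_iff[THEN iffD2])

definition half :: nat where "half = (q ^ n - 1) div 2"

text \<open>Euler's criterion. For odd \<open>q\<close> the value at 0 is -1 and not the customary
  0, so that all values are signs; multiplicativity is claimed for nonzero elements only.\<close>

definition sign :: "'k \<Rightarrow> real" where "sign x = (if x ^ half = 1 then 1 else - 1)"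

lemma card_K: "card K = q ^ n"
  using bij_betw_same_card[OF bij] by (simp add: q_eq n_eq)

lemma finite_K: "finite K"
  using bij_betw_finite[OF bij] by simp

lemma phi_K [simp]: "\<phi> a \<in> K"
  using bij by (auto simp: bij_betw_def)

lemma phi_0 [simp]: "\<phi> 0 = 0"
  using phi_add[of 0 0] by (metis add.right_neutral add_left_cancel)

lemma phi_eq_iff [simp]: "\<phi> a = \<phi> b \<longleftrightarrow> a = b"
  using bij by (auto simp: bij_betw_def inj_on_def)

lemma phi_eq_0_iff [simp]: "\<phi> a = 0 \<longleftrightarrow> a = 0"
  using phi_eq_iff[of a 0] by simp

lemma phi_surj: "x \<in> K \<Longrightarrow> \<exists>a. x = \<phi> a"
  using bij by (auto simp: bij_betw_def)

lemma zero_K: "0 \<in> K"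
  using phi_K[of 0] by simp

lemma unit_power_K:
  assumes "x \<in> K" "x \<noteq> 0"
  shows "x ^ (q ^ n - 1) = 1"
proof -
  have "x * x ^ (q ^ n - 1) = x * 1"
    using frobenius_K[OF assms(1)]
    by (metis One_nat_def Suc_pred mult.right_neutral power_Suc q_pos zero_less_power)
  then show ?thesis using assms(2) by (metis mult_left_cancel)
qed

lemma inverse_K:
  assumes "x \<in> K"
  shows "inverse x \<in> K"
proof (cases "x = 0")
  case False
  have pow: "x ^ k \<in> K" for k
    by (induction k) (auto intro: mult_K one_K assms)
  have "q ^ n > 1"
    using q_ge_2 n_pos by (intro one_less_power) auto
  then have "x * x ^ (q ^ n - 2) = x ^ (q ^ n - 1)"
    by (metis Suc_1 Suc_diff_Suc power_Suc One_nat_def)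
  then have "inverse x = x ^ (q ^ n - 2)"
    using unit_power_K[OF assms False] by (metis inverse_unique)
  then show ?thesis using pow by simp
qed (use zero_K in simp)

lemma bij_mult_K:
  assumes "y \<in> K" "y \<noteq> 0"
  shows "bij_betw (\<lambda>x. x * y) (K - {0}) (K - {0})"
proof (rule bij_betwI)
  show "(\<lambda>x. x * y) \<in> K - {0} \<rightarrow> K - {0}" using assms by (auto intro: mult_K)
  show "(\<lambda>x. x * inverse y) \<in> K - {0} \<rightarrow> K - {0}" using assms by (auto intro: mult_K inverse_K)
qed (use assms in \<open>auto simp: mult.assoc\<close>)

lemma sign_cases: "sign x = 1 \<or> sign x = - 1"
  by (simp add: sign_def)

lemma power_half_cases:
  assumes "odd q" "x \<in> K" "x \<noteq> 0"
  shows "x ^ half = 1 \<or> x ^ half = - 1"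
proof -
  have "even (q ^ n - 1)" using assms(1) by simp
  then have "half * 2 = q ^ n - 1" unfolding half_def by simp
  then have "(x ^ half)\<^sup>2 = 1"
    using unit_power_K[OF assms(2,3)] by (simp flip: power_mult)
  then show ?thesis by (simp add: power2_eq_1_iff)
qed

lemma sign_mult:
  assumes "odd q" "x \<in> K" "x \<noteq> 0" "y \<in> K" "y \<noteq> 0"
  shows "sign (x * y) = sign x * sign y"
  using power_half_cases[OF assms(1,2,3)] power_half_cases[OF assms(1,4,5)]
  by (auto simp: sign_def power_mult_distrib)

lemma half_pos: "odd q \<Longrightarrow> 0 < half"
proof -
  assume "odd q"
  then have "q \<ge> 3" using q_ge_2 by (cases "q = 2") auto
  moreover have "q ^ 1 \<le> q ^ n" using n_pos q_pos by (intro power_increasing) auto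
  ultimately show ?thesis unfolding half_def by simp
qed

text \<open>There are twice \<open>half\<close> nonzero elements but at most \<open>half\<close>
  solutions of x^half = 1, so some \<open>g\<close> has sign -1; multiplying the summation variable
  by \<open>g\<close> negates the sum.\<close>

lemma sum_sign:
  assumes "odd q"
  shows "(\<Sum>x\<in>K - {0}. sign x) = 0"
proof -
  have "card {x :: 'k. x ^ half = 1} \<le> half"
    using half_pos[OF assms] by (rule card_roots_of_unity_le)
  moreover have "half < card (K - {0})"
    using half_pos[OF assms] zero_K finite_K by (simp add: card_K half_def)
  moreover have "finite {x :: 'k. x ^ half = 1}"
    using half_pos[OF assms] by (rule finite_roots_of_unity)
  ultimately have "\<not> K - {0} \<subseteq> {x. x ^ half = 1}"
    using card_mono by (metis not_le order_trans)
  then obtain g where g: "g \<in> K" "g \<noteq> 0" "g ^ half \<noteq> 1" by blast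
  then have sg: "sign g = - 1" by (simp add: sign_def)
  have "(\<Sum>x\<in>K - {0}. sign x) = (\<Sum>x\<in>K - {0}. sign (x * g))"
    by (rule sum.reindex_bij_betw[OF bij_mult_K[OF g(1,2)], symmetric])
  also have "\<dots> = (\<Sum>x\<in>K - {0}. - sign x)"
    using g sg by (intro sum.cong refl) (simp add: sign_mult[OF assms])
  finally show ?thesis by (simp add: sum_negf)
qed

lemma sign_iota_even:
  assumes "odd q" "even n" "c \<noteq> 0"
  shows "sign (\<iota> c) = 1"
proof -
  obtain k where "n = 2 * k" using assms(2) by blast
  then have "c ^ half = 1"
    using power_half_even[OF assms(1,3)] unfolding half_def by metis
  then show ?thesis by (simp add: sign_def iota_power iota_1_iff)
qed

text \<open>For n = 2k + 1, q^n - 1 = q (q^(2k) - 1) + (q - 1), so on scalars the exponent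
  \<open>half\<close> acts like (q - 1) / 2. The restriction is the quadratic character of the base
  field, which is nontrivial by the same root count as in \<open>sum_sign\<close>.\<close>

lemma sum_sign_iota_odd:
  assumes "odd q" "odd n"
  shows "(\<Sum>c\<in>UNIV - {0}. sign (\<iota> c)) = 0"
proof -
  obtain k where k: "n = 2 * k + 1" using assms(2) by (elim oddE)
  let ?h = "(q - 1) div 2"
  have q3: "q \<ge> 3" using q_ge_2 assms(1) by (cases "q = 2") auto
  have "c ^ half = c ^ ?h" if "c \<noteq> 0" for c :: 'a
  proof -
    have ev: "even (q ^ (2 * k) - 1)" "even (q - 1)" using assms(1) by auto
    have "q ^ n - 1 = q * (q ^ (2 * k) - 1) + (q - 1)"
      using q3 by (simp add: k algebra_simps)
    then have "half = q * ((q ^ (2 * k) - 1) div 2) + ?h"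
      unfolding half_def using ev by (metis div_mult_swap div_plus_div_distrib_dvd_right)
    moreover have "c ^ ((q ^ (2 * k) - 1) div 2) = 1"
      using power_half_even[OF assms(1) that] .
    ultimately show ?thesis
      by (simp only: power_add power_mult mult.commute[of q]) simp
  qed
  moreover have "\<exists>c::'a. c \<noteq> 0 \<and> c ^ ?h \<noteq> 1"
  proof (rule ccontr)
    assume "\<not> ?thesis"
    then have "UNIV - {0} \<subseteq> {c :: 'a. c ^ ?h = 1}" by auto
    then have "card (UNIV - {0::'a}) \<le> card {c :: 'a. c ^ ?h = 1}" by (intro card_mono) auto
    also have "\<dots> \<le> ?h" using q3 by (intro card_roots_of_unity_le) auto
    finally show False using q3 by (simp add: card_Diff_singleton q_eq)
  qed
  ultimately obtain g :: 'a where g: "g \<noteq> 0" "g ^ half \<noteq> 1" by metis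
  then have sg: "sign (\<iota> g) = - 1" by (simp add: sign_def iota_power iota_1_iff)
  have "(\<Sum>c\<in>UNIV - {0}. sign (\<iota> c)) = (\<Sum>c\<in>UNIV - {0}. sign (\<iota> (c * g)))"
    by (rule sum.reindex_bij_witness[of _ "\<lambda>c. c * g" "\<lambda>c. c / g"]) (use g in auto)
  also have "\<dots> = (\<Sum>c\<in>UNIV - {0}. - sign (\<iota> c))"
    using g sg by (intro sum.cong refl) (simp add: iota_mult sign_mult[OF assms(1)] iota_K iota_0_iff)
  finally show ?thesis by (simp add: sum_negf)
qed

section \<open>The dot product as a bilinear form on the extension field\<close>

definition coord :: "'k \<Rightarrow> 'a ^ 'n" where "coord = inv_into UNIV \<phi>"

lemma coord_phi [simp]: "coord (\<phi> a) = a"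
  unfolding coord_def using bij by (simp add: bij_betw_def)

lemma phi_diff: "\<phi> (a - b) = \<phi> a - \<phi> b"
  using phi_add[of "a - b" b] by (simp add: eq_diff_eq)

text \<open>Any nonzero linear functional would do, for instance the trace.\<close>

definition functional :: "'k \<Rightarrow> 'a" where "functional x = coord x $ undefined"

lemma functional_add:
  assumes "x \<in> K" "y \<in> K"
  shows "functional (x + y) = functional x + functional y"
proof -
  obtain a b where "x = \<phi> a" "y = \<phi> b" using assms phi_surj by metis
  then show ?thesis by (simp add: functional_def flip: phi_add)
qed

lemma functional_scale:
  assumes "x \<in> K"
  shows "functional (\<iota> c * x) = c * functional x"
proof -
  obtain a where "x = \<phi> a" using assms phi_surj by metis
  then show ?thesis by (simp add: functional_def flip: phi_scale)
qed

lemma functional_nonzero: "\<exists>w\<in>K. functional w = 1"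
  by (rule bexI[of _ "\<phi> (axis undefined 1)"]) (simp_all add: functional_def)

text \<open>With L for \<open>functional\<close>, this is the vector representing x -> L (x y) in
  the standard dot product. It identifies the second copy of \<open>'a ^ 'n\<close> with the field,
  in general otherwise than \<open>\<phi>\<close> does; hence the two functions \<open>h\<close> and
  \<open>h'\<close>.\<close>

definition dual :: "'k \<Rightarrow> 'a ^ 'n" where "dual y = (\<chi> i. functional (\<phi> (axis i 1) * y))"

lemma dot_dual:
  assumes "y \<in> K"
  shows "dot a (dual y) = functional (\<phi> a * y)"
proof -
  have "functional (\<phi> a * y) = dot a (\<chi> i. functional (\<phi> (axis i 1) * y))"
  proof (rule linear_functional_eq_dot)
    show "functional (\<phi> (a + b) * y) = functional (\<phi> a * y) + functional (\<phi> b * y)" for a b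
      using assms by (simp add: phi_add ring_distribs functional_add mult_K)
    show "functional (\<phi> (c *s a) * y) = c * functional (\<phi> a * y)" for c a
      using assms by (simp add: phi_scale mult.assoc functional_scale mult_K)
  qed
  then show ?thesis by (simp add: dual_def)
qed

lemma dual_scale:
  assumes "y \<in> K"
  shows "dual (\<iota> c * y) = c *s dual y"
  using assms by (simp add: dual_def vec_eq_iff functional_scale mult_K mult.left_commute[of _ "\<iota> c"])

lemma dual_bij: "bij_betw dual K UNIV"
proof -
  have "inj_on dual K"
  proof (rule inj_onI)
    fix y y' assume y: "y \<in> K" "y' \<in> K" "dual y = dual y'"
    obtain b b' where b: "y = \<phi> b" "y' = \<phi> b'" using y phi_surj by metis
    have dK: "y - y' \<in> K" unfolding b phi_diff[symmetric] by simp
    show "y = y'"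
    proof (rule ccontr)
      assume "y \<noteq> y'"
      then have d0: "y - y' \<noteq> 0" by simp
      \<comment> \<open>If the two functionals agreed, L would vanish on all multiples of y - y',
        hence on the whole field; the multiple \<open>w\<close> refutes this.\<close>
      obtain w where w: "w \<in> K" "functional w = 1" using functional_nonzero by blast
      have "w * inverse (y - y') \<in> K" by (intro mult_K w inverse_K dK)
      then obtain a where a: "\<phi> a = w * inverse (y - y')" using phi_surj by metis
      have "\<phi> a * y = \<phi> a * y' + w"
        using d0 unfolding a by (simp add: field_simps)
      then have "functional (\<phi> a * y) = functional (\<phi> a * y') + 1"
        using w y by (simp add: functional_add mult_K)
      then show False using dot_dual[OF y(1), of a] dot_dual[OF y(2), of a] y(3) by simp
    qed
  qed
  moreover have "dual ` K = UNIV"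
  proof (rule card_subset_eq)
    show "card (dual ` K) = CARD('a ^ 'n)"
      using calculation by (simp add: card_image card_K q_eq n_eq)
  qed auto
  ultimately show ?thesis by (simp add: bij_betw_def)
qed

lemma dual_0: "dual 0 = 0"
  using dual_scale[OF one_K, of 0] iota_0_iff[of 0] by simp

lemma sign_vectors_model:
  assumes "odd q"
  shows "\<exists>h h' s \<kappa>. sign_vectors (h :: 'a ^ 'n \<Rightarrow> real) h' s \<kappa>"
proof -
  define g where "g = inv_into K dual"
  have gK: "g b \<in> K" for b
    unfolding g_def using dual_bij by (metis UNIV_I bij_betw_def inv_into_into)
  have dual_g: "dual (g b) = b" for b
    unfolding g_def using dual_bij by (metis UNIV_I bij_betw_def f_inv_into_f)
  have g_dual: "g (dual y) = y" if "y \<in> K" for y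
    unfolding g_def using dual_bij that by (simp add: bij_betw_def)
  have g0: "g b \<noteq> 0" if "b \<noteq> 0" for b
    using dual_g[of b] that by (metis dual_0)
  have g_scale: "g (c *s b) = \<iota> c * g b" for c b
    using g_dual[of "\<iota> c * g b"] by (simp add: dual_scale gK mult_K iota_K dual_g)
  have bij_phi: "bij_betw \<phi> (UNIV - {0}) (K - {0})"
    using bij_betw_DiffI[OF bij, of "{0}" "{0}"] by (simp add: bij_betw_def zero_K)
  have bij_dual: "bij_betw dual (K - {0}) (UNIV - {0})"
    using bij_betw_DiffI[OF dual_bij, of "{0}" "{0}"] by (simp add: bij_betw_def dual_0 zero_K)
  have "sign_vectors (\<lambda>a. sign (\<phi> a)) (\<lambda>b. sign (g b))
    (\<lambda>t. \<Sum>z\<in>{z \<in> K - {0}. functional z = t}. sign z) (\<lambda>c. sign (\<iota> c))"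
  proof
    show "sign (\<phi> a) \<in> {1, -1}" "sign (g a) \<in> {1, -1}" for a
      by (auto simp: sign_def)
    show "(\<Sum>a\<in>UNIV - {0}. sign (\<phi> a)) = 0"
      using sum.reindex_bij_betw[OF bij_phi, of sign] sum_sign[OF assms] by simp
    have "(\<Sum>a\<in>UNIV - {0}. sign (g a)) = (\<Sum>y\<in>K - {0}. sign (g (dual y)))"
      by (rule sum.reindex_bij_betw[OF bij_dual, symmetric])
    also have "\<dots> = (\<Sum>y\<in>K - {0}. sign y)" by (intro sum.cong) (auto simp: g_dual)
    finally show "(\<Sum>a\<in>UNIV - {0}. sign (g a)) = 0" using sum_sign[OF assms] by simp
    show "(\<Sum>a\<in>{a \<in> UNIV - {0}. dot a b = t}. sign (\<phi> a))
        = (\<Sum>z\<in>{z \<in> K - {0}. functional z = t}. sign z) * sign (g b)" if b: "b \<noteq> 0" for t b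
    proof -
      define y where "y = g b"
      have y: "y \<in> K" "y \<noteq> 0" using gK g0 b by (auto simp: y_def)
      have dot: "dot a b = functional (\<phi> a * y)" for a
        using dot_dual[OF y(1), of a] by (simp add: y_def dual_g)
      have "(\<Sum>z\<in>{z \<in> K - {0}. functional z = t}. sign z)
        = (\<Sum>a\<in>{a \<in> UNIV - {0}. dot a b = t}. sign (\<phi> a * y))"
      proof (rule sum.reindex_bij_witness[of _ "\<lambda>a. \<phi> a * y" "\<lambda>z. coord (z * inverse y)"])
        fix z assume z: "z \<in> {z \<in> K - {0}. functional z = t}"
        have "z * inverse y \<in> K" using z y by (auto intro: mult_K inverse_K)
        then have phic: "\<phi> (coord (z * inverse y)) = z * inverse y"
          using phi_surj by (metis coord_phi)
        then show c: "\<phi> (coord (z * inverse y)) * y = z" using y by simp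
        have "dot (coord (z * inverse y)) b = t"
          unfolding dot c using z by simp
        moreover have "coord (z * inverse y) \<noteq> 0"
          using phic z y by (metis DiffD2 insertI1 inverse_nonzero_iff_nonzero mem_Collect_eq mult_eq_0_iff phi_0)
        ultimately show "coord (z * inverse y) \<in> {a \<in> UNIV - {0}. dot a b = t}" by simp
        show "sign (\<phi> (coord (z * inverse y)) * y) = sign z" using c by simp
      next
        fix a assume a: "a \<in> {a \<in> UNIV - {0}. dot a b = t}"
        show "coord (\<phi> a * y * inverse y) = a" using y by (simp add: mult.assoc)
        show "\<phi> a * y \<in> {z \<in> K - {0}. functional z = t}"
          using a y by (simp add: dot mult_K)
      qed
      also have "\<dots> = (\<Sum>a\<in>{a \<in> UNIV - {0}. dot a b = t}. sign (\<phi> a)) * sign y"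
        unfolding sum_distrib_right using y by (intro sum.cong refl sign_mult[OF assms]) simp_all
      \<comment> \<open>The substitution leaves \<open>sign y\<close> on the side of the hyperplane
        sum; being its own inverse, it can be moved across.\<close>
      finally show ?thesis using sign_cases[of y] by (auto simp: y_def)
    qed
    show "sign (\<phi> (c *s a)) = sign (\<iota> c) * sign (\<phi> a)" if "c \<noteq> 0" "a \<noteq> 0" for c a
      using that by (simp add: phi_scale sign_mult[OF assms] iota_K iota_0_iff)
    show "sign (g (c *s a)) = sign (\<iota> c) * sign (g a)" if "c \<noteq> 0" "a \<noteq> 0" for c a
      using that by (simp add: g_scale sign_mult[OF assms] iota_K iota_0_iff gK g0)
    show "sign (\<iota> c) = 1" if "even CARD('n)" "c \<noteq> 0" for c
      using sign_iota_even[OF assms] that by (simp add: n_eq)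
    show "(\<Sum>c\<in>UNIV - {0}. sign (\<iota> c)) = 0" if "odd CARD('n)"
      using sum_sign_iota_odd[OF assms] that by (simp add: n_eq)
  qed
  then show ?thesis by blast
qed

end

lemma sign_vectors_exist:
  assumes "odd CARD('a::{field,finite})"
  shows "\<exists>h h' s \<kappa>. sign_vectors (h :: 'a ^ 'n::finite \<Rightarrow> real) h' s \<kappa>"
proof -
  obtain K and \<phi> :: "'a ^ 'n \<Rightarrow> 'a alg_closure"
    where "extension_model K to_ac \<phi> CARD('a) CARD('n)"
    using extension_model_exists by blast
  then show ?thesis using assms by (rule extension_model.sign_vectors_model)
qed

section \<open>Second moments\<close>

text \<open>Fibres are cosets of the kernel: translation by a preimage of y - z carries the fibre of
  z to that of y.\<close>

lemma card_fibre_additive: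
  fixes f :: "'v::{ab_group_add,finite} \<Rightarrow> 'w::{ab_group_add,finite}"
  assumes diff: "\<And>x y. f (x - y) = f x - f y" and "surj f"
  shows "CARD('w) * card {x. f x = y} = CARD('v)"
proof -
  have eq: "card {x. f x = z} = card {x. f x = y}" for z
  proof -
    obtain u where u: "f u = y - z" using \<open>surj f\<close> by (metis surjD)
    have f0: "f 0 = 0" using diff[of 0 0] by simp
    have minus: "f (- x) = - f x" for x using diff[of 0 x] f0 by simp
    have add: "f (x + x') = f x + f x'" for x x' using diff[of x "- x'"] minus by simp
    have "bij_betw (\<lambda>x. x + u) {x. f x = z} {x. f x = y}"
      by (rule bij_betwI[where g = "\<lambda>x. x - u"]) (auto simp: add diff u)
    then show ?thesis by (rule bij_betw_same_card)
  qed
  have "CARD('v) = card (\<Union>z. {x. f x = z})"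
    by (rule arg_cong[of _ _ card]) auto
  also have "\<dots> = (\<Sum>z\<in>UNIV. card {x. f x = z})"
    by (rule card_UN_disjoint) auto
  also have "\<dots> = (\<Sum>z\<in>(UNIV :: 'w set). card {x. f x = y})"
    by (intro sum.cong refl eq)
  finally show ?thesis by simp
qed

lemma vec_nonzero_component: "(a :: 'a::field ^ 'n) \<noteq> 0 \<Longrightarrow> \<exists>i. a $ i \<noteq> 0"
  by (metis vec_eq_iff zero_index)

text \<open>The zero vector is counted here. It lies in the fibre of 0 only, which is why a -1
  enters for \<open>Um0\<close> and not for \<open>Um\<close>.\<close>

lemma card_dot_eq:
  fixes a :: "'a::{field,finite} ^ 'n::finite"
  assumes "a \<noteq> 0"
  shows "real (card {b. dot a b = t}) = real CARD('a) ^ (CARD('n) - 1)"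
proof -
  let ?Q = "real CARD('a)"
  obtain i where i: "a $ i \<noteq> 0" using vec_nonzero_component[OF assms] by blast
  have "dot a (axis i (u / a $ i)) = u" for u using i by (simp add: dot_axis)
  then have "surj (dot a)" by (rule surjI[of "dot a" "\<lambda>u. axis i (u / a $ i)"])
  then have "CARD('a) * card {b. dot a b = t} = CARD('a ^ 'n)"
    by (rule card_fibre_additive[OF dot_diff_right])
  then have "real (CARD('a) * card {b. dot a b = t}) = real (CARD('a ^ 'n))"
    by (rule arg_cong)
  then have "?Q * real (card {b. dot a b = t}) = ?Q ^ CARD('n)"
    by simp
  also have "\<dots> = ?Q * ?Q ^ (CARD('n) - 1)"
    by (simp flip: power_Suc)
  finally show ?thesis by simp
qed

text \<open>Two independent functionals map jointly onto pairs of scalars, so each joint fibre has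
  q^(n-2) elements.\<close>

lemma card_dot_dot_eq:
  fixes a a' :: "'a::{field,finite} ^ 'n::finite"
  assumes "a \<noteq> 0" "a' \<noteq> 0" "(a, a') \<notin> proportional" "CARD('n) \<ge> 2"
  shows "real (card {b. dot a b = t \<and> dot a' b = t'}) = real CARD('a) ^ (CARD('n) - 2)"
proof -
  let ?Q = "real CARD('a)"
  obtain i where i: "a $ i \<noteq> 0" using vec_nonzero_component[OF assms(1)] by blast
  define c where "c = a' $ i / a $ i"
  have "a' \<noteq> c *s a"
  proof
    assume eq: "a' = c *s a"
    then have "c \<noteq> 0" using assms(2) by auto
    then show False using eq assms(1-3) by (auto simp: proportional_def)
  qed
  then obtain j where j: "a' $ j \<noteq> c * a $ j" by (auto simp: vec_eq_iff)
  have "surj (\<lambda>b. (dot a b, dot a' b))"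
  proof -
    have "\<exists>b. p = (dot a b, dot a' b)" for p
    proof -
      obtain u u' where p: "p = (u, u')" by (cases p)
      \<comment> \<open>Elimination in the coordinates i and j: the row a' - c a vanishes at i but
        not at j, so \<open>r\<close> is determined first and \<open>s\<close> by back
        substitution.\<close>
      define r where "r = (u' - c * u) / (a' $ j - c * a $ j)"
      define s where "s = (u - a $ j * r) / a $ i"
      have r: "r * (a' $ j - c * a $ j) = u' - c * u" using j by (simp add: r_def)
      have s: "a $ i * s = u - a $ j * r" using i by (simp add: s_def)
      have "a' $ i = c * a $ i" using i by (simp add: c_def)
      then have "a' $ i * s + a' $ j * r = c * (a $ i * s) + a' $ j * r" by simp
      also have "\<dots> = c * u + r * (a' $ j - c * a $ j)" unfolding s by (simp add: algebra_simps)
      also have "\<dots> = u'" unfolding r by simp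
      finally have "dot a' (axis i s + axis j r) = u'" by (simp add: dot_add_right dot_axis)
      moreover have "dot a (axis i s + axis j r) = u" by (simp add: dot_add_right dot_axis s)
      ultimately show ?thesis unfolding p by blast
    qed
    then show ?thesis unfolding surj_def by (intro allI)
  qed
  then have "CARD('a \<times> 'a) * card {b. (dot a b, dot a' b) = (t, t')} = CARD('a ^ 'n)"
    by (intro card_fibre_additive) (simp_all add: dot_diff_right)
  then have "(CARD('a) * CARD('a)) * card {b. dot a b = t \<and> dot a' b = t'} = CARD('a) ^ CARD('n)"
    by simp
  then have "real (CARD('a) * CARD('a) * card {b. dot a b = t \<and> dot a' b = t'})
      = real (CARD('a) ^ CARD('n))"
    by (rule arg_cong)
  then have "?Q * ?Q * real (card {b. dot a b = t \<and> dot a' b = t'}) = ?Q ^ CARD('n)"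
    by (simp only: of_nat_mult of_nat_power)
  also have "\<dots> = ?Q * ?Q * ?Q ^ (CARD('n) - 2)"
  proof -
    have "?Q ^ CARD('n) = ?Q ^ (2 + (CARD('n) - 2))"
      using assms(4) by (simp only: le_add_diff_inverse)
    then show ?thesis unfolding power_add power2_eq_square .
  qed
  finally show ?thesis by simp
qed

text \<open>The entries of T^t T are the numbers of common neighbours; this is the squared norm of T
  f written as a quadratic form in f.\<close>

lemma sum_square_eq_sum_common:
  fixes f :: "'v \<Rightarrow> real"
  assumes "finite A" "finite B"
  shows "(\<Sum>b\<in>B. (\<Sum>a\<in>{a\<in>A. R a b}. f a)\<^sup>2)
    = (\<Sum>a\<in>A. \<Sum>a'\<in>A. f a * f a' * real (card {b\<in>B. R a b \<and> R a' b}))"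
proof -
  let ?i = "\<lambda>a b. if R a b then 1 else 0 :: real"
  have inner: "(\<Sum>a\<in>{a\<in>A. R a b}. f a) = (\<Sum>a\<in>A. f a * ?i a b)" for b
    unfolding sum.inter_filter[OF assms(1)] by (intro sum.cong) auto
  have "(\<Sum>b\<in>B. (\<Sum>a\<in>{a\<in>A. R a b}. f a)\<^sup>2) = (\<Sum>b\<in>B. (\<Sum>a\<in>A. f a * ?i a b)\<^sup>2)"
    by (simp only: inner)
  also have "\<dots> = (\<Sum>b\<in>B. \<Sum>a\<in>A. \<Sum>a'\<in>A. f a * f a' * (?i a b * ?i a' b))"
    by (simp add: power2_eq_square sum_product mult_ac)
  also have "\<dots> = (\<Sum>a\<in>A. \<Sum>b\<in>B. \<Sum>a'\<in>A. f a * f a' * (?i a b * ?i a' b))"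
    by (rule sum.swap)
  also have "\<dots> = (\<Sum>a\<in>A. \<Sum>a'\<in>A. \<Sum>b\<in>B. f a * f a' * (?i a b * ?i a' b))"
    by (intro sum.cong refl sum.swap)
  also have "\<dots> = (\<Sum>a\<in>A. \<Sum>a'\<in>A. f a * f a' * real (card {b\<in>B. R a b \<and> R a' b}))"
  proof (intro sum.cong refl)
    fix a a'
    have "(\<Sum>b\<in>B. ?i a b * ?i a' b) = (\<Sum>b\<in>B. if R a b \<and> R a' b then 1 else 0)"
      by (intro sum.cong) auto
    also have "\<dots> = real (card {b\<in>B. R a b \<and> R a' b})"
      using assms(2) by (simp add: sum.inter_filter[symmetric])
    finally show "(\<Sum>b\<in>B. f a * f a' * (?i a b * ?i a' b))
        = f a * f a' * real (card {b\<in>B. R a b \<and> R a' b})"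
      by (simp add: sum_distrib_left[symmetric])
  qed
  finally show ?thesis .
qed

text \<open>Up to the factor q - 1, the orthogonal projection onto the functions constant on lines
  through the origin.\<close>

definition line_sum :: "('a::{field,finite} ^ 'n::finite \<Rightarrow> real) \<Rightarrow> 'a ^ 'n \<Rightarrow> real" where
  "line_sum f a = (\<Sum>c\<in>UNIV - {0}. f (c *s a))"

lemma smult_right_cancel:
  fixes a :: "'a::field ^ 'n::finite"
  assumes "a \<noteq> 0" "c *s a = c' *s a"
  shows "c = c'"
proof -
  obtain i where "a $ i \<noteq> 0" using vec_nonzero_component[OF assms(1)] by blast
  moreover have "c * a $ i = c' * a $ i"
    using assms(2) by (metis vector_smult_component)
  ultimately show ?thesis by simp
qed

lemma proportional_Image:
  assumes "a \<noteq> 0"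
  shows "proportional `` {a} = (\<lambda>c. c *s a) ` (UNIV - {0})"
  using assms by (auto simp: proportional_def)

lemma sum_proportional:
  fixes a :: "'a::{field,finite} ^ 'n::finite"
  assumes "a \<noteq> 0"
  shows "(\<Sum>a'\<in>proportional `` {a}. f a') = line_sum f a"
  unfolding proportional_Image[OF assms] line_sum_def
  by (subst sum.reindex) (auto intro!: inj_onI smult_right_cancel[OF assms])

lemma sum_nonzero_scale:
  fixes f :: "'a::{field,finite} ^ 'n::finite \<Rightarrow> real"
  assumes "c \<noteq> 0"
  shows "(\<Sum>a\<in>UNIV - {0}. f (c *s a)) = (\<Sum>a\<in>UNIV - {0}. f a)"
  by (rule sum.reindex_bij_witness[of _ "\<lambda>a. inverse c *s a" "\<lambda>a. c *s a"])
    (use assms in \<open>auto simp: vector_smult_assoc\<close>)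

lemma line_sum_scale:
  assumes "c \<noteq> 0"
  shows "line_sum f (c *s a) = line_sum f a"
  unfolding line_sum_def
  by (rule sum.reindex_bij_witness[of _ "\<lambda>c'. c' / c" "\<lambda>c'. c' * c"])
    (use assms in \<open>auto simp: vector_smult_assoc\<close>)

text \<open>As for any multiple of a projection, the squared norm of \<open>line_sum f\<close> is q
  - 1 times the inner product of \<open>f\<close> with \<open>line_sum f\<close>.\<close>

lemma sum_line_sum_nonneg:
  fixes f :: "'a::{field,finite} ^ 'n::finite \<Rightarrow> real"
  shows "0 \<le> (\<Sum>a\<in>UNIV - {0}. f a * line_sum f a)"
proof -
  have "(\<Sum>a\<in>UNIV - {0}. (line_sum f a)\<^sup>2)
      = (\<Sum>a\<in>UNIV - {0}. \<Sum>c\<in>UNIV - {0}. f (c *s a) * line_sum f a)"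
    by (simp add: power2_eq_square sum_distrib_right line_sum_def[of f])
  also have "\<dots> = (\<Sum>c\<in>UNIV - {0}. \<Sum>a\<in>UNIV - {0}. f (c *s a) * line_sum f a)"
    by (rule sum.swap)
  also have "\<dots> = (\<Sum>c\<in>UNIV - {0::'a}. \<Sum>a\<in>UNIV - {0}. f a * line_sum f a)"
  proof (rule sum.cong[OF refl])
    fix c :: 'a assume c: "c \<in> UNIV - {0}"
    then have "(\<Sum>a\<in>UNIV - {0}. f (c *s a) * line_sum f a)
        = (\<Sum>a\<in>UNIV - {0}. f (c *s a) * line_sum f (c *s a))"
      by (simp add: line_sum_scale)
    also have "\<dots> = (\<Sum>a\<in>UNIV - {0}. f a * line_sum f a)"
      using c by (intro sum_nonzero_scale[of c "\<lambda>a. f a * line_sum f a"]) simp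
    finally show "(\<Sum>a\<in>UNIV - {0}. f (c *s a) * line_sum f a)
        = (\<Sum>a\<in>UNIV - {0}. f a * line_sum f a)" .
  qed
  also have "\<dots> = real (CARD('a) - 1) * (\<Sum>a\<in>UNIV - {0}. f a * line_sum f a)"
    by (simp add: card_Diff_singleton)
  finally have eq: "(\<Sum>a\<in>UNIV - {0}. (line_sum f a)\<^sup>2)
      = real (CARD('a) - 1) * (\<Sum>a\<in>UNIV - {0}. f a * line_sum f a)" .
  have "0 \<le> real (CARD('a) - 1) * (\<Sum>a\<in>UNIV - {0}. f a * line_sum f a)"
    unfolding eq[symmetric] by (rule sum_nonneg) simp
  moreover have "0 < real (CARD('a) - 1)" using CARD_field_ge_2[where 'a='a] by simp
  ultimately show ?thesis by (simp add: zero_le_mult_iff)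
qed

lemma sum_sum_proportional:
  fixes f :: "'a::{field,finite} ^ 'n::finite \<Rightarrow> real"
  shows "(\<Sum>a\<in>UNIV - {0}. \<Sum>a'\<in>UNIV - {0}. f a * f a' * (if (a, a') \<in> proportional then 1 else 0))
    = (\<Sum>a\<in>UNIV - {0}. f a * line_sum f a)"
proof (rule sum.cong[OF refl])
  fix a :: "'a ^ 'n" assume a: "a \<in> UNIV - {0}"
  have "proportional `` {a} = {a' \<in> UNIV - {0}. (a, a') \<in> proportional}"
    by (auto simp: proportional_def)
  then have "line_sum f a = (\<Sum>a'\<in>{a' \<in> UNIV - {0}. (a, a') \<in> proportional}. f a')"
    using sum_proportional[of a f] a by simp
  also have "\<dots> = (\<Sum>a'\<in>UNIV - {0}. if (a, a') \<in> proportional then f a' else 0)"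
    by (rule sum.inter_filter) simp
  finally have "f a * line_sum f a
      = (\<Sum>a'\<in>UNIV - {0}. f a * (if (a, a') \<in> proportional then f a' else 0))"
    by (simp only: sum_distrib_left)
  also have "\<dots> = (\<Sum>a'\<in>UNIV - {0}. f a * f a' * (if (a, a') \<in> proportional then 1 else 0))"
    by (intro sum.cong) auto
  finally show "(\<Sum>a'\<in>UNIV - {0}. f a * f a' * (if (a, a') \<in> proportional then 1 else 0))
      = f a * line_sum f a" by simp
qed

text \<open>The number of common neighbours is q^(n-1) for equal vectors, 0 for distinct
  proportional ones and q^(n-2) otherwise.\<close>

lemma second_moment_dot_1:
  fixes f :: "'a::{field,finite} ^ 'n::finite \<Rightarrow> real"
  assumes n: "CARD('n) \<ge> 2"
  defines "Q \<equiv> real CARD('a)"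
  shows "(\<Sum>b\<in>UNIV - {0}. (\<Sum>a\<in>{a \<in> UNIV - {0}. dot a b = 1}. f a)\<^sup>2)
    = Q ^ (CARD('n) - 1) * (\<Sum>a\<in>UNIV - {0}. (f a)\<^sup>2)
      + Q ^ (CARD('n) - 2) * ((\<Sum>a\<in>UNIV - {0}. f a)\<^sup>2 - (\<Sum>a\<in>UNIV - {0}. f a * line_sum f a))"
proof -
  let ?V = "UNIV - {0 :: 'a ^ 'n}"
  let ?X = "Q ^ (CARD('n) - 1)" and ?Y = "Q ^ (CARD('n) - 2)"
  have common: "real (card {b\<in>?V. dot a b = 1 \<and> dot a' b = 1})
      = ?X * (if a' = a then 1 else 0) + ?Y * (1 - (if (a, a') \<in> proportional then 1 else 0))"
    if a: "a \<in> ?V" "a' \<in> ?V" for a a'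
  proof -
    have V: "{b\<in>?V. dot a b = 1 \<and> dot a' b = 1} = {b. dot a b = 1 \<and> dot a' b = 1}"
      by (auto simp: dot_def)
    have refl: "(a, a) \<in> proportional"
      using a equiv_proportional by (auto simp: equiv_def refl_on_def)
    show ?thesis
    proof (cases "(a, a') \<in> proportional")
      case False
      then have "a' \<noteq> a" using refl by auto
      then show ?thesis unfolding V using False a card_dot_dot_eq[OF _ _ False n] by (simp add: Q_def)
    next
      case True
      then obtain c where c: "c \<noteq> 0" "a' = c *s a" by (auto simp: proportional_def)
      show ?thesis
      proof (cases "a' = a")
        case True
        then show ?thesis unfolding V using refl a card_dot_eq[of a 1] by (simp add: Q_def)
      next
        case False
        \<comment> \<open>Both dot products being 1 would force c = 1.\<close>
        then have "c \<noteq> 1" using c by auto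
        then have "{b. dot a b = 1 \<and> dot a' b = 1} = {}" by (auto simp: c dot_scale_left)
        then show ?thesis unfolding V using True False by simp
      qed
    qed
  qed
  have "(\<Sum>b\<in>?V. (\<Sum>a\<in>{a \<in> ?V. dot a b = 1}. f a)\<^sup>2)
      = (\<Sum>a\<in>?V. \<Sum>a'\<in>?V. f a * f a' * real (card {b\<in>?V. dot a b = 1 \<and> dot a' b = 1}))"
    by (rule sum_square_eq_sum_common) auto
  also have "\<dots> = (\<Sum>a\<in>?V. \<Sum>a'\<in>?V. ?X * (if a' = a then f a * f a' else 0) + ?Y * (f a * f a')
      - ?Y * (f a * f a' * (if (a, a') \<in> proportional then 1 else 0)))"
    by (intro sum.cong refl) (simp only: common, simp add: algebra_simps)
  also have "\<dots> = ?X * (\<Sum>a\<in>?V. \<Sum>a'\<in>?V. if a' = a then f a * f a' else 0)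
      + ?Y * (\<Sum>a\<in>?V. \<Sum>a'\<in>?V. f a * f a')
      - ?Y * (\<Sum>a\<in>?V. \<Sum>a'\<in>?V. f a * f a' * (if (a, a') \<in> proportional then 1 else 0))"
    by (simp only: sum.distrib sum_subtractf sum_distrib_left)
  also have "(\<Sum>a\<in>?V. \<Sum>a'\<in>?V. if a' = a then f a * f a' else 0) = (\<Sum>a\<in>?V. (f a)\<^sup>2)"
    by (intro sum.cong refl) (simp add: power2_eq_square)
  also have "(\<Sum>a\<in>?V. \<Sum>a'\<in>?V. f a * f a') = (\<Sum>a\<in>?V. f a)\<^sup>2"
    by (simp add: power2_eq_square sum_product)
  also note sum_sum_proportional
  finally show ?thesis by (simp add: algebra_simps)
qed

text \<open>Proportional vectors now have the same neighbours, so two cases remain: q^(n-1) - 1 for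
  proportional vectors and q^(n-2) - 1 otherwise, after removal of the zero vector.\<close>

lemma second_moment_dot_0:
  fixes f :: "'a::{field,finite} ^ 'n::finite \<Rightarrow> real"
  assumes n: "CARD('n) \<ge> 2"
  defines "Q \<equiv> real CARD('a)"
  shows "(\<Sum>b\<in>UNIV - {0}. (\<Sum>a\<in>{a \<in> UNIV - {0}. dot a b = 0}. f a)\<^sup>2)
    = (Q ^ (CARD('n) - 2) - 1) * (\<Sum>a\<in>UNIV - {0}. f a)\<^sup>2
      + (Q ^ (CARD('n) - 1) - Q ^ (CARD('n) - 2)) * (\<Sum>a\<in>UNIV - {0}. f a * line_sum f a)"
proof -
  let ?V = "UNIV - {0 :: 'a ^ 'n}"
  let ?X = "Q ^ (CARD('n) - 1)" and ?Y = "Q ^ (CARD('n) - 2)"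
  have common: "real (card {b\<in>?V. dot a b = 0 \<and> dot a' b = 0})
      = (?Y - 1) + (?X - ?Y) * (if (a, a') \<in> proportional then 1 else 0)"
    if a: "a \<in> ?V" "a' \<in> ?V" for a a'
  proof -
    let ?D = "{b. dot a b = 0 \<and> dot a' b = 0}"
    have "{b\<in>?V. dot a b = 0 \<and> dot a' b = 0} = ?D - {0}" by auto
    moreover have "0 \<in> ?D" by (simp add: dot_def)
    ultimately have "card {b\<in>?V. dot a b = 0 \<and> dot a' b = 0} = card ?D - 1" "card ?D > 0"
      by (simp_all add: card_gt_0_iff) blast
    then have V: "real (card {b\<in>?V. dot a b = 0 \<and> dot a' b = 0}) = real (card ?D) - 1"
      by (simp add: of_nat_diff)
    show ?thesis
    proof (cases "(a, a') \<in> proportional")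
      case False
      then show ?thesis unfolding V using a card_dot_dot_eq[OF _ _ False n] by (simp add: Q_def)
    next
      case True
      then obtain c where c: "c \<noteq> 0" "a' = c *s a" by (auto simp: proportional_def)
      then have "?D = {b. dot a b = 0}" by (auto simp: dot_scale_left)
      then show ?thesis unfolding V using True a card_dot_eq[of a 0] by (simp add: Q_def)
    qed
  qed
  have "(\<Sum>b\<in>?V. (\<Sum>a\<in>{a \<in> ?V. dot a b = 0}. f a)\<^sup>2)
      = (\<Sum>a\<in>?V. \<Sum>a'\<in>?V. f a * f a' * real (card {b\<in>?V. dot a b = 0 \<and> dot a' b = 0}))"
    by (rule sum_square_eq_sum_common) auto
  also have "\<dots> = (\<Sum>a\<in>?V. \<Sum>a'\<in>?V. (?Y - 1) * (f a * f a')
      + (?X - ?Y) * (f a * f a' * (if (a, a') \<in> proportional then 1 else 0)))"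
    by (intro sum.cong refl) (simp only: common, simp add: algebra_simps)
  also have "\<dots> = (?Y - 1) * (\<Sum>a\<in>?V. \<Sum>a'\<in>?V. f a * f a')
      + (?X - ?Y) * (\<Sum>a\<in>?V. \<Sum>a'\<in>?V. f a * f a' * (if (a, a') \<in> proportional then 1 else 0))"
    by (simp only: sum.distrib sum_distrib_left)
  also have "(\<Sum>a\<in>?V. \<Sum>a'\<in>?V. f a * f a') = (\<Sum>a\<in>?V. f a)\<^sup>2"
    by (simp add: power2_eq_square sum_product)
  also note sum_sum_proportional
  finally show ?thesis .
qed

section \<open>The graph Um\<close>

lemma Um_eq_bipartite_graph:
  "Um = bipartite_graph (UNIV - {0}) (UNIV - {0}) (\<lambda>a b. dot a b = 1)"
  by (auto simp: Um_def bipartite_graph_def)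

lemma card_nonzero_vectors:
  "real (card (UNIV - {0 :: 'a::{field,finite} ^ 'n::finite})) = real CARD('a) ^ CARD('n) - 1"
  by (simp add: card_Diff_singleton of_nat_diff Suc_leI)

lemma card_power_gt_1: "real CARD('a::{field,finite}) ^ CARD('n::finite) > 1"
  using CARD_field_ge_2[where 'a='a] by (intro one_less_power) auto

lemma regular_bipartite_Um:
  "regular_bipartite (UNIV - {0 :: 'a::{field,finite} ^ 'n::finite}) (UNIV - {0}) (\<lambda>a b. dot a b = 1)
    (real CARD('a) ^ (CARD('n) - 1)) (real CARD('a) ^ CARD('n) - 1)"
proof
  have *: "{b \<in> UNIV - {0}. dot a b = 1} = {b. dot a b = 1}" for a :: "'a ^ 'n"
    by (auto simp: dot_def)
  show "real (card {b \<in> UNIV - {0}. dot a b = 1}) = real CARD('a) ^ (CARD('n) - 1)"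
    if "a \<in> UNIV - {0}" for a :: "'a ^ 'n"
    unfolding * using that by (intro card_dot_eq) simp
  then show "real (card {a \<in> UNIV - {0}. dot a b = 1}) = real CARD('a) ^ (CARD('n) - 1)"
    if "b \<in> UNIV - {0}" for b :: "'a ^ 'n"
    using that by (simp add: dot_commute[of _ b])
  show "real CARD('a) ^ CARD('n) - 1 > 0" using card_power_gt_1[where 'a='a and 'n='n] by simp
qed (simp_all only: card_nonzero_vectors, simp_all)

text \<open>On functions of sum zero the line sum term of the second moment is nonnegative and
  enters with a minus sign; dropping it leaves q^(n-1), the square of the singular value
  bound.\<close>

lemma isoperimetric_Um_lower:
  assumes n: "CARD('n::finite) \<ge> 2"
  defines "Q \<equiv> real CARD('a::{field,finite})"
  shows "isoperimetric (Um :: ('a ^ 'n + 'a ^ 'n) graph)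
    \<ge> (Q ^ (CARD('n) - 1) - sqrt (Q ^ (CARD('n) - 1))) / 2"
proof -
  interpret regular_bipartite "UNIV - {0 :: 'a ^ 'n}" "UNIV - {0}" "\<lambda>a b. dot a b = 1"
      "real CARD('a) ^ (CARD('n) - 1)" "real CARD('a) ^ CARD('n) - 1"
    by (rule regular_bipartite_Um)
  have Q: "Q \<ge> 2" using CARD_field_ge_2[where 'a='a] by (simp add: Q_def)
  then have Q1: "Q ^ (CARD('n) - 1) \<ge> 1" by (intro one_le_power) simp
  show ?thesis
    unfolding Um_eq_bipartite_graph Q_def
  proof (rule isoperimetric_lower; fold Q_def)
    show "0 < sqrt (Q ^ (CARD('n) - 1))" using Q1 by simp
    show "sqrt (Q ^ (CARD('n) - 1)) \<le> Q ^ (CARD('n) - 1)"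
      using Q1 by (intro real_le_lsqrt) (simp_all add: power2_eq_square)
    fix f :: "'a ^ 'n \<Rightarrow> real" assume f0: "(\<Sum>a\<in>UNIV - {0}. f a) = 0"
    have "0 \<le> Q ^ (CARD('n) - 2) * (\<Sum>a\<in>UNIV - {0}. f a * line_sum f a)"
      using Q by (intro mult_nonneg_nonneg sum_line_sum_nonneg) simp
    then show "(\<Sum>b\<in>UNIV - {0}. (\<Sum>a\<in>{a \<in> UNIV - {0}. dot a b = 1}. f a)\<^sup>2)
        \<le> (sqrt (Q ^ (CARD('n) - 1)))\<^sup>2 * (\<Sum>a\<in>UNIV - {0}. (f a)\<^sup>2)"
      using second_moment_dot_1[OF n, of f, folded Q_def] f0 Q1 by simp
  qed
qed

lemma line_sum_eq_multiple:
  assumes "\<And>c. c \<noteq> 0 \<Longrightarrow> h (c *s a) = \<kappa> c * h a"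
  shows "line_sum h a = (\<Sum>c\<in>UNIV - {0}. \<kappa> c) * h a"
  unfolding line_sum_def sum_distrib_right using assms by (intro sum.cong) auto

lemma isoperimetric_Um_upper:
  assumes n: "CARD('n::finite) \<ge> 2" and q_odd: "odd CARD('a::{field,finite})"
  defines "Q \<equiv> real CARD('a)"
  shows "isoperimetric (Um :: ('a ^ 'n + 'a ^ 'n) graph)
    \<le> (Q ^ (CARD('n) - 1) - sqrt (Q ^ (if odd CARD('n) then CARD('n) - 1 else CARD('n) - 2))) / 2"
proof -
  interpret G: regular_bipartite "UNIV - {0 :: 'a ^ 'n}" "UNIV - {0}" "\<lambda>a b. dot a b = 1"
      "real CARD('a) ^ (CARD('n) - 1)" "real CARD('a) ^ CARD('n) - 1"
    by (rule regular_bipartite_Um)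
  let ?V = "UNIV - {0 :: 'a ^ 'n}"
  obtain h h' s \<kappa> where "sign_vectors (h :: 'a ^ 'n \<Rightarrow> real) h' s \<kappa>"
    using sign_vectors_exist[OF q_odd] by blast
  then interpret sign_vectors h h' s \<kappa> .
  define k where "k = (\<Sum>c\<in>UNIV - {0}. \<kappa> c)"
  define m where "m = Q ^ CARD('n) - 1"
  have m: "m > 0" using card_power_gt_1[where 'a='a and 'n='n] by (simp add: m_def Q_def)
  have sq: "(h a)\<^sup>2 = 1" "(h' a)\<^sup>2 = 1" for a
    using h[of a] h'[of a] by auto
  \<comment> \<open>Compares squared norms: that of \<open>h'\<close> is m, since its values square
    to 1, and that of the transform of \<open>h\<close> follows from the second moment, where line
    sums multiply \<open>h\<close> by \<open>k\<close>.\<close>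
  have "(s 1)\<^sup>2 * m = (\<Sum>b\<in>?V. (s 1 * h' b)\<^sup>2)"
    by (simp add: power_mult_distrib sq m_def Q_def)
  also have "\<dots> = (\<Sum>b\<in>?V. (\<Sum>a\<in>{a \<in> ?V. dot a b = 1}. h a)\<^sup>2)"
    by (intro sum.cong refl arg_cong[of _ _ "\<lambda>x. x\<^sup>2"] sum_hyperplane[symmetric]) simp
  also have "\<dots> = Q ^ (CARD('n) - 1) * (\<Sum>a\<in>?V. (h a)\<^sup>2)
      - Q ^ (CARD('n) - 2) * (\<Sum>a\<in>?V. h a * line_sum h a)"
    using second_moment_dot_1[OF n, of h, folded Q_def] sum_h by simp
  also have "(\<Sum>a\<in>?V. h a * line_sum h a) = (\<Sum>a\<in>?V. k * (h a)\<^sup>2)"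
    by (intro sum.cong refl) (simp add: k_def line_sum_eq_multiple[OF h_scale] power2_eq_square)
  also have "Q ^ (CARD('n) - 1) * (\<Sum>a\<in>?V. (h a)\<^sup>2) - Q ^ (CARD('n) - 2) * (\<Sum>a\<in>?V. k * (h a)\<^sup>2)
      = (Q ^ (CARD('n) - 1) - Q ^ (CARD('n) - 2) * k) * m"
    by (simp add: sq m_def Q_def algebra_simps)
  finally have s2: "(s 1)\<^sup>2 = Q ^ (CARD('n) - 1) - Q ^ (CARD('n) - 2) * k"
    using m by simp
  have "(s 1)\<^sup>2 = Q ^ (if odd CARD('n) then CARD('n) - 1 else CARD('n) - 2)"
  proof (cases "odd CARD('n)")
    case True
    then show ?thesis using s2 kappa_odd by (simp add: k_def)
  next
    case False
    \<comment> \<open>The trivial character sums to q - 1, so q^(n-1) - q^(n-2) k drops to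
      q^(n-2).\<close>
    then have "k = Q - 1"
      using kappa_even by (simp add: k_def Q_def card_Diff_singleton of_nat_diff Suc_leI)
    moreover have "Q ^ (CARD('n) - 1) = Q ^ (CARD('n) - 2) * Q"
    proof -
      have "CARD('n) - 1 = Suc (CARD('n) - 2)" using n by simp
      then show ?thesis by (simp only: power_Suc mult.commute)
    qed
    ultimately have "(s 1)\<^sup>2 = Q ^ (CARD('n) - 2)"
      unfolding s2 by (simp add: right_diff_distrib)
    then show ?thesis using False by simp
  qed
  then have abs: "\<bar>s 1\<bar> = sqrt (Q ^ (if odd CARD('n) then CARD('n) - 1 else CARD('n) - 2))"
    by (metis real_sqrt_abs)
  show ?thesis
    unfolding Um_eq_bipartite_graph abs[symmetric] unfolding Q_def
    by (rule G.isoperimetric_upper_abs[OF h h' sum_h sum_h' sum_hyperplane]) simp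
qed

section \<open>The graph Um0\<close>

abbreviation points :: "('a::field ^ 'n) set set" where
  "points \<equiv> (UNIV - {0}) // proportional"

text \<open>Stated for arbitrary sets of vectors; on classes the choice of representatives is
  immaterial by \<open>incident_class_iff\<close>.\<close>

definition incident :: "('a::field ^ 'n) set \<Rightarrow> ('a ^ 'n) set \<Rightarrow> bool" where
  "incident x y \<longleftrightarrow> (\<exists>a\<in>x. \<exists>b\<in>y. dot a b = 0)"

lemma incident_commute: "incident x y \<longleftrightarrow> incident y x"
  unfolding incident_def using dot_commute by metis

lemma incident_class_iff:
  assumes "a \<noteq> 0" "b \<noteq> 0"
  shows "incident (proportional `` {a}) (proportional `` {b}) \<longleftrightarrow> dot a b = 0"
proof
  assume "incident (proportional `` {a}) (proportional `` {b})"
  then show "dot a b = 0" unfolding incident_def using dot_eq_0_cong by blast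
next
  assume "dot a b = 0"
  moreover have "(a, a) \<in> proportional" "(b, b) \<in> proportional"
    using assms equiv_proportional by (auto simp: equiv_def refl_on_def)
  ultimately show "incident (proportional `` {a}) (proportional `` {b})"
    unfolding incident_def by blast
qed

lemma points_cases:
  assumes "x \<in> points"
  obtains a where "a \<noteq> 0" "x = proportional `` {a}"
  using assms by (auto elim: quotientE)

lemma class_in_points: "a \<noteq> 0 \<Longrightarrow> proportional `` {a} \<in> points"
  by (auto intro: quotientI)

lemma Um0_eq_bipartite_graph: "Um0 = bipartite_graph points points incident"
proof -
  have "{{Inl (proportional `` {a}), Inr (proportional `` {b})} | a b.
          a \<noteq> 0 \<and> b \<noteq> 0 \<and> dot a b = 0}
      = {{Inl x, Inr y} | x y :: ('a ^ 'n) set. x \<in> points \<and> y \<in> points \<and> incident x y}" (is "?L = ?R")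
  proof (intro equalityI subsetI)
    fix e assume "e \<in> ?L"
    then obtain a b :: "'a ^ 'n" where "e = {Inl (proportional `` {a}), Inr (proportional `` {b})}"
      "a \<noteq> 0" "b \<noteq> 0" "dot a b = 0" by auto
    then show "e \<in> ?R" using class_in_points incident_class_iff by blast
  next
    fix e assume "e \<in> ?R"
    then obtain x y :: "('a ^ 'n) set" where e: "e = {Inl x, Inr y}"
      "x \<in> points" "y \<in> points" "incident x y" by auto
    obtain a where a: "a \<noteq> 0" "x = proportional `` {a}" using points_cases[OF e(2)] .
    obtain b where b: "b \<noteq> 0" "y = proportional `` {b}" using points_cases[OF e(3)] .
    have "dot a b = 0" using e(4) a b incident_class_iff by blast
    then show "e \<in> ?L" using e(1) a b by blast
  qed
  then show ?thesis by (simp add: Um0_def bipartite_graph_def)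
qed

text \<open>Each class consists of q - 1 vectors. All sums over points are computed by pulling back
  to vectors through this identity.\<close>

lemma sum_classes:
  fixes g :: "('a::{field,finite} ^ 'n::finite) set \<Rightarrow> real"
  shows "(\<Sum>a\<in>UNIV - {0}. g (proportional `` {a})) = (real CARD('a) - 1) * (\<Sum>x\<in>points. g x)"
proof -
  let ?V = "UNIV - {0 :: 'a ^ 'n}" and ?cls = "\<lambda>a :: 'a ^ 'n. proportional `` {a}"
  have "(\<Sum>a\<in>?V. g (?cls a)) = (\<Sum>x\<in>points. \<Sum>a\<in>{a \<in> ?V. ?cls a = x}. g (?cls a))"
    by (rule sum.group[symmetric]) (auto intro: class_in_points)
  also have "\<dots> = (\<Sum>x\<in>points. (real CARD('a) - 1) * g x)"
  proof (intro sum.cong refl)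
    fix x :: "('a ^ 'n) set" assume "x \<in> points"
    then obtain a where a: "a \<noteq> 0" "x = ?cls a" by (rule points_cases)
    have "{a' \<in> ?V. ?cls a' = x} = ?cls a"
    proof (intro equalityI subsetI)
      fix a' assume "a' \<in> {a' \<in> ?V. ?cls a' = x}"
      then have "?cls a = ?cls a'" "a' \<in> ?V" using a by auto
      then show "a' \<in> ?cls a"
        using eq_equiv_class[OF _ equiv_proportional] by blast
    next
      fix a' assume "a' \<in> ?cls a"
      then have "(a, a') \<in> proportional" by simp
      then have "?cls a = ?cls a'" by (rule equiv_class_eq[OF equiv_proportional])
      moreover have "a' \<noteq> 0" using \<open>(a, a') \<in> proportional\<close> by (simp add: proportional_def)
      ultimately show "a' \<in> {a' \<in> ?V. ?cls a' = x}" using a by simp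
    qed
    moreover have "card (?cls a) = CARD('a) - 1"
      unfolding proportional_Image[OF a(1)]
      by (subst card_image) (auto intro!: inj_onI smult_right_cancel[OF a(1)] simp: card_Diff_singleton)
    ultimately have "real (card {a' \<in> ?V. ?cls a' = x}) = real CARD('a) - 1"
      by (simp add: of_nat_diff Suc_leI)
    then show "(\<Sum>a\<in>{a \<in> ?V. ?cls a = x}. g (?cls a)) = (real CARD('a) - 1) * g x" by simp
  qed
  finally show ?thesis by (simp add: sum_distrib_left)
qed

lemma sum_incident_classes:
  fixes b :: "'a::{field,finite} ^ 'n::finite" and g :: "('a ^ 'n) set \<Rightarrow> real"
  assumes "b \<noteq> 0"
  shows "(\<Sum>x\<in>{x \<in> points. incident x (proportional `` {b})}. g x)
    = (\<Sum>a\<in>{a \<in> UNIV - {0}. dot a b = 0}. g (proportional `` {a})) / (real CARD('a) - 1)"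
proof -
  let ?g = "\<lambda>x. if incident x (proportional `` {b}) then g x else 0"
  have Q: "real CARD('a) - 1 > 0" using CARD_field_ge_2[where 'a='a] by simp
  have "(\<Sum>a\<in>{a \<in> UNIV - {0}. dot a b = 0}. g (proportional `` {a}))
      = (\<Sum>a\<in>UNIV - {0}. if dot a b = 0 then g (proportional `` {a}) else 0)"
    by (rule sum.inter_filter) simp
  also have "\<dots> = (\<Sum>a\<in>UNIV - {0}. ?g (proportional `` {a}))"
    using assms by (intro sum.cong refl) (simp add: incident_class_iff)
  also have "\<dots> = (real CARD('a) - 1) * (\<Sum>x\<in>points. ?g x)"
    by (rule sum_classes)
  also have "(\<Sum>x\<in>points. ?g x) = (\<Sum>x\<in>{x \<in> points. incident x (proportional `` {b})}. g x)"
    by (rule sum.inter_filter[symmetric]) simp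
  finally show ?thesis using Q by simp
qed

lemma regular_bipartite_Um0:
  "regular_bipartite (points :: ('a::{field,finite} ^ 'n::finite) set set) points incident
    ((real CARD('a) ^ (CARD('n) - 1) - 1) / (real CARD('a) - 1))
    ((real CARD('a) ^ CARD('n) - 1) / (real CARD('a) - 1))"
proof
  have Q: "real CARD('a) - 1 > 0" using CARD_field_ge_2[where 'a='a] by simp
  have "real CARD('a) ^ CARD('n) - 1 = (real CARD('a) - 1) * real (card (points :: ('a ^ 'n) set set))"
    using sum_classes[of "\<lambda>_ :: ('a ^ 'n) set. 1 :: real"] card_nonzero_vectors[where 'a='a and 'n='n]
    by simp
  then show "real (card (points :: ('a ^ 'n) set set)) = (real CARD('a) ^ CARD('n) - 1) / (real CARD('a) - 1)"
    using Q by (simp add: field_simps)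
  show "finite (points :: ('a ^ 'n) set set)" by simp
  show "(real CARD('a) ^ CARD('n) - 1) / (real CARD('a) - 1) > 0"
    using Q card_power_gt_1[where 'a='a and 'n='n] by simp
  show "real (card {x \<in> points. incident x y}) = (real CARD('a) ^ (CARD('n) - 1) - 1) / (real CARD('a) - 1)"
    if y: "y \<in> points" for y :: "('a ^ 'n) set"
  proof -
    obtain b where b: "b \<noteq> 0" "y = proportional `` {b}" using points_cases[OF y] .
    \<comment> \<open>Removing the zero vector from the hyperplane produces the -1 in the
      degree.\<close>
    have "{a \<in> UNIV - {0}. dot a b = 0} = {a. dot b a = 0} - {0}"
      by (auto simp: dot_commute)
    moreover have "0 \<in> {a. dot b a = 0}" by (simp add: dot_def)
    ultimately have "card {a \<in> UNIV - {0}. dot a b = 0} = card {a. dot b a = 0} - 1"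
      "card {a. dot b a = 0} > 0"
      by (simp_all add: card_gt_0_iff) blast
    then have "real (card {a \<in> UNIV - {0}. dot a b = 0}) = real CARD('a) ^ (CARD('n) - 1) - 1"
      using card_dot_eq[OF b(1), of 0] by (simp add: of_nat_diff)
    then show ?thesis using sum_incident_classes[OF b(1), of "\<lambda>_. 1"] b(2) by simp
  qed
  then show "real (card {y \<in> points. incident x y}) = (real CARD('a) ^ (CARD('n) - 1) - 1) / (real CARD('a) - 1)"
    if "x \<in> points" for x :: "('a ^ 'n) set"
    using that by (simp add: incident_commute[of x])
qed

text \<open>The pullback \<open>f\<close> of \<open>g\<close> is constant on lines, so line sums
  multiply it by q - 1 and an equality results: all sum-zero functions on points share one singular
  value. Any sign vector on points therefore attains the lower bound.\<close>

lemma second_moment_points: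
  fixes g :: "('a::{field,finite} ^ 'n::finite) set \<Rightarrow> real"
  assumes n: "CARD('n) \<ge> 2" and g0: "(\<Sum>x\<in>points. g x) = 0"
  shows "(\<Sum>y\<in>points. (\<Sum>x\<in>{x \<in> points. incident x y}. g x)\<^sup>2)
    = real CARD('a) ^ (CARD('n) - 2) * (\<Sum>x\<in>points. (g x)\<^sup>2)"
proof -
  define Q where "Q = real CARD('a)"
  let ?V = "UNIV - {0 :: 'a ^ 'n}" and ?Y = "Q ^ (CARD('n) - 2)"
  define f where "f = (\<lambda>a :: 'a ^ 'n. g (proportional `` {a}))"
  define F where "F = (\<lambda>y. (\<Sum>x\<in>{x \<in> points. incident x y}. g x)\<^sup>2)"
  have Q: "Q - 1 > 0" using CARD_field_ge_2[where 'a='a] by (simp add: Q_def)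
  have line: "line_sum f a = (Q - 1) * f a" if "a \<noteq> 0" for a
  proof -
    have "f (c *s a) = 1 * f a" if "c \<noteq> 0" for c
    proof -
      have "(a, c *s a) \<in> proportional" using \<open>a \<noteq> 0\<close> that by (auto simp: proportional_def)
      then show ?thesis
        unfolding f_def using equiv_class_eq[OF equiv_proportional] by (metis mult_1)
    qed
    then have "line_sum f a = (\<Sum>c\<in>UNIV - {0::'a}. 1) * f a" by (rule line_sum_eq_multiple)
    then show ?thesis by (simp add: Q_def card_Diff_singleton of_nat_diff Suc_leI)
  qed
  have f0: "(\<Sum>a\<in>?V. f a) = 0" unfolding f_def sum_classes g0 by simp
  have "(Q - 1) * (\<Sum>y\<in>points. F y) = (\<Sum>b\<in>?V. F (proportional `` {b}))"
    unfolding Q_def by (rule sum_classes[symmetric])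
  \<comment> \<open>Each incident point has q - 1 representatives, so every inner sum carries a
    factor 1 / (q - 1) before squaring.\<close>
  also have "\<dots> = (\<Sum>b\<in>?V. (\<Sum>a\<in>{a \<in> ?V. dot a b = 0}. f a)\<^sup>2 / (Q - 1)\<^sup>2)"
    by (intro sum.cong refl) (simp add: F_def f_def Q_def sum_incident_classes power_divide)
  also have "\<dots> = (\<Sum>b\<in>?V. (\<Sum>a\<in>{a \<in> ?V. dot a b = 0}. f a)\<^sup>2) / (Q - 1)\<^sup>2"
    by (rule sum_divide_distrib[symmetric])
  also have "(\<Sum>b\<in>?V. (\<Sum>a\<in>{a \<in> ?V. dot a b = 0}. f a)\<^sup>2)
      = (Q ^ (CARD('n) - 1) - ?Y) * (\<Sum>a\<in>?V. f a * line_sum f a)"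
    using second_moment_dot_0[OF n, of f, folded Q_def] f0 by simp
  also have "(\<Sum>a\<in>?V. f a * line_sum f a) = (Q - 1) * (\<Sum>a\<in>?V. (f a)\<^sup>2)"
    unfolding sum_distrib_left by (intro sum.cong refl) (simp add: line power2_eq_square)
  also have "(\<Sum>a\<in>?V. (f a)\<^sup>2) = (Q - 1) * (\<Sum>x\<in>points. (g x)\<^sup>2)"
    unfolding f_def Q_def by (rule sum_classes)
  also have "Q ^ (CARD('n) - 1) - ?Y = ?Y * (Q - 1)"
  proof -
    have "CARD('n) - 1 = Suc (CARD('n) - 2)" using n by simp
    then show ?thesis by (simp add: algebra_simps)
  qed
  also have "?Y * (Q - 1) * ((Q - 1) * ((Q - 1) * (\<Sum>x\<in>points. (g x)\<^sup>2))) / (Q - 1)\<^sup>2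
      = (Q - 1) * (?Y * (\<Sum>x\<in>points. (g x)\<^sup>2))"
    using Q by (simp add: power2_eq_square)
  finally show ?thesis using Q by (simp add: F_def Q_def)
qed

lemma isoperimetric_Um0_lower:
  assumes n: "CARD('n::finite) \<ge> 2"
  defines "Q \<equiv> real CARD('a::{field,finite})"
  shows "isoperimetric (Um0 :: (('a ^ 'n) set + ('a ^ 'n) set) graph)
    \<ge> ((Q ^ (CARD('n) - 1) - 1) / (Q - 1) - sqrt (Q ^ (CARD('n) - 2))) / 2"
proof -
  interpret regular_bipartite "points :: ('a ^ 'n) set set" points incident
      "(real CARD('a) ^ (CARD('n) - 1) - 1) / (real CARD('a) - 1)"
      "(real CARD('a) ^ CARD('n) - 1) / (real CARD('a) - 1)"
    by (rule regular_bipartite_Um0)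
  have Q: "Q \<ge> 2" using CARD_field_ge_2[where 'a='a] by (simp add: Q_def)
  then have Q1: "Q ^ (CARD('n) - 2) \<ge> 1" by (intro one_le_power) simp
  show ?thesis
    unfolding Um0_eq_bipartite_graph Q_def
  proof (rule isoperimetric_lower; fold Q_def)
    show "0 < sqrt (Q ^ (CARD('n) - 2))" using Q1 by simp
    have "sqrt (Q ^ (CARD('n) - 2)) \<le> Q ^ (CARD('n) - 2)"
      using Q1 by (intro real_le_lsqrt) (simp_all add: power2_eq_square)
    also have "\<dots> \<le> (Q ^ (CARD('n) - 1) - 1) / (Q - 1)"
    proof -
      have "CARD('n) - 1 = Suc (CARD('n) - 2)" using n by simp
      then have "Q ^ (CARD('n) - 2) * (Q - 1) \<le> Q ^ (CARD('n) - 1) - 1"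
        using Q1 by (simp add: algebra_simps)
      then show ?thesis using Q by (simp add: pos_le_divide_eq)
    qed
    finally show "sqrt (Q ^ (CARD('n) - 2)) \<le> (Q ^ (CARD('n) - 1) - 1) / (Q - 1)" .
    fix g :: "('a ^ 'n) set \<Rightarrow> real" assume "(\<Sum>x\<in>points. g x) = 0"
    from second_moment_points[OF n this, folded Q_def]
    show "(\<Sum>y\<in>points. (\<Sum>x\<in>{x \<in> points. incident x y}. g x)\<^sup>2)
        \<le> (sqrt (Q ^ (CARD('n) - 2)))\<^sup>2 * (\<Sum>x\<in>points. (g x)\<^sup>2)"
      using Q1 by simp
  qed
qed

text \<open>For even n the character is trivial on scalars, so \<open>h\<close> and
  \<open>h'\<close> are constant on classes and descend to points, whatever representative
  \<open>rep\<close> picks.\<close>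

lemma isoperimetric_Um0_upper:
  assumes n: "CARD('n::finite) \<ge> 2" "even CARD('n)" and q_odd: "odd CARD('a::{field,finite})"
  defines "Q \<equiv> real CARD('a)"
  shows "isoperimetric (Um0 :: (('a ^ 'n) set + ('a ^ 'n) set) graph)
    \<le> ((Q ^ (CARD('n) - 1) - 1) / (Q - 1) - sqrt (Q ^ (CARD('n) - 2))) / 2"
proof -
  interpret G: regular_bipartite "points :: ('a ^ 'n) set set" points incident
      "(real CARD('a) ^ (CARD('n) - 1) - 1) / (real CARD('a) - 1)"
      "(real CARD('a) ^ CARD('n) - 1) / (real CARD('a) - 1)"
    by (rule regular_bipartite_Um0)
  let ?V = "UNIV - {0 :: 'a ^ 'n}"
  let ?P = "points :: ('a ^ 'n) set set"
  obtain h h' s \<kappa> where "sign_vectors (h :: 'a ^ 'n \<Rightarrow> real) h' s \<kappa>"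
    using sign_vectors_exist[OF q_odd] by blast
  then interpret sign_vectors h h' s \<kappa> .
  define rep :: "('a ^ 'n) set \<Rightarrow> 'a ^ 'n" where "rep = (\<lambda>x. SOME a. a \<in> x)"
  define g g' where "g = (\<lambda>x. h (rep x))" and "g' = (\<lambda>x. h' (rep x))"
  have rep: "\<exists>c. c \<noteq> 0 \<and> rep (proportional `` {a}) = c *s a" if "a \<noteq> 0" for a
  proof -
    have "a \<in> proportional `` {a}" using that equiv_proportional by (auto simp: equiv_def refl_on_def)
    then have "rep (proportional `` {a}) \<in> proportional `` {a}"
      unfolding rep_def by (metis someI)
    then show ?thesis by (auto simp: proportional_def)
  qed
  have g: "g (proportional `` {a}) = h a" and g': "g' (proportional `` {a}) = h' a" if "a \<noteq> 0" for a
  proof -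
    from rep[OF that] obtain c where "c \<noteq> 0" "rep (proportional `` {a}) = c *s a" by blast
    then show "g (proportional `` {a}) = h a" "g' (proportional `` {a}) = h' a"
      using h_scale[of c a] h'_scale[of c a] that kappa_even[OF n(2), of c] by (simp_all add: g_def g'_def)
  qed
  have Q: "Q - 1 > 0" using CARD_field_ge_2[where 'a='a] by (simp add: Q_def)
  define m where "m = (Q ^ CARD('n) - 1) / (Q - 1)"
  have m: "m > 0" using G.m_pos by (simp add: m_def Q_def)
  have cP: "real (card ?P) = m" unfolding m_def Q_def by (rule G.card_A)
  \<comment> \<open>A sum over the vectors of a hyperplane counts each of its points q - 1
    times.\<close>
  define s0 where "s0 = s 0 / (Q - 1)"
  have g0: "(\<Sum>x\<in>?P. g x) = 0"
  proof -
    have "(Q - 1) * (\<Sum>x\<in>?P. g x) = (\<Sum>a\<in>?V. h a)"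
      unfolding Q_def sum_classes[symmetric] by (intro sum.cong refl) (simp add: g)
    then show ?thesis using sum_h Q by simp
  qed
  have g0': "(\<Sum>x\<in>?P. g' x) = 0"
  proof -
    have "(Q - 1) * (\<Sum>x\<in>?P. g' x) = (\<Sum>a\<in>?V. h' a)"
      unfolding Q_def sum_classes[symmetric] by (intro sum.cong refl) (simp add: g')
    then show ?thesis using sum_h' Q by simp
  qed
  have gsv: "(\<Sum>x\<in>{x \<in> ?P. incident x y}. g x) = s0 * g' y" if y: "y \<in> ?P" for y
  proof -
    obtain b where b: "b \<noteq> 0" "y = proportional `` {b}" using points_cases[OF y] .
    have "(\<Sum>a\<in>{a \<in> ?V. dot a b = 0}. g (proportional `` {a})) = (\<Sum>a\<in>{a \<in> ?V. dot a b = 0}. h a)"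
      by (intro sum.cong refl) (simp add: g)
    then show ?thesis
      unfolding b(2) sum_incident_classes[OF b(1)] g'[OF b(1)] using sum_hyperplane[OF b(1), of 0]
      by (simp add: s0_def Q_def)
  qed
  have sq: "(g x)\<^sup>2 = 1" "(g' x)\<^sup>2 = 1" for x
    using h[of "rep x"] h'[of "rep x"] by (auto simp: g_def g'_def)
  have "s0\<^sup>2 * m = (\<Sum>y\<in>?P. (s0 * g' y)\<^sup>2)"
    by (simp add: power_mult_distrib sq cP mult.commute)
  also have "\<dots> = (\<Sum>y\<in>?P. (\<Sum>x\<in>{x \<in> ?P. incident x y}. g x)\<^sup>2)"
    by (intro sum.cong refl) (simp add: gsv)
  also have "\<dots> = Q ^ (CARD('n) - 2) * m"
    unfolding second_moment_points[OF n(1) g0] by (simp add: sq cP Q_def)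
  finally have "s0\<^sup>2 = Q ^ (CARD('n) - 2)" using m by simp
  then have abs: "\<bar>s0\<bar> = sqrt (Q ^ (CARD('n) - 2))"
    by (metis real_sqrt_abs)
  show ?thesis
    unfolding Um0_eq_bipartite_graph abs[symmetric] unfolding Q_def
  proof (rule G.isoperimetric_upper_abs)
    show "g x \<in> {1, -1}" "g' x \<in> {1, -1}" for x using h h' by (simp_all only: g_def g'_def)
  qed (use g0 g0' gsv in auto)
qed

text \<open>The exponents (n - 1) / 2 and n / 2 - 1 may be half-integers; the bounds are proved with
  square roots of natural powers and converted here.\<close>

lemma powr_half_eq_sqrt:
  assumes "x > 0" "r = real k / 2"
  shows "x powr r = sqrt (x ^ k)"
proof -
  have "x powr r = (x powr real k) powr (1 / 2)" by (simp add: assms(2) powr_powr)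
  also have "\<dots> = sqrt (x ^ k)" using assms(1) by (simp add: powr_realpow powr_half_sqrt)
  finally show ?thesis .
qed

theorem theorem1p5:
  fixes q n :: nat
  assumes "CARD('a::{field,finite}) = q" and "odd q"
    and "CARD('n::finite) = n"
  shows
    "(n \<ge> 2 \<longrightarrow>
       (odd n \<longrightarrow>
          isoperimetric (Um :: ('a ^ 'n + 'a ^ 'n) graph)
            = 1 / 2 * (real q ^ (n - 1) - real q powr ((real n - 1) / 2))) \<and>
       (even n \<longrightarrow>
          1 / 2 * (real q ^ (n - 1) - real q powr (real n / 2 - 1))
            \<ge> isoperimetric (Um :: ('a ^ 'n + 'a ^ 'n) graph) \<and>
          isoperimetric (Um :: ('a ^ 'n + 'a ^ 'n) graph)
            \<ge> 1 / 2 * (real q ^ (n - 1) - real q powr ((real n - 1) / 2)))) \<and>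
     (n \<ge> 3 \<longrightarrow>
       (odd n \<longrightarrow>
          isoperimetric (Um0 :: (('a ^ 'n) set + ('a ^ 'n) set) graph)
            \<ge> 1 / 2 * ((real q ^ (n - 1) - 1) / (real q - 1) - real q powr (real n / 2 - 1))) \<and>
       (even n \<longrightarrow>
          isoperimetric (Um0 :: (('a ^ 'n) set + ('a ^ 'n) set) graph)
            = 1 / 2 * ((real q ^ (n - 1) - 1) / (real q - 1) - real q powr (real n / 2 - 1))))"
proof (cases "n \<ge> 2")
  case n: True
  have q: "real q > 0" using assms(1) by (simp flip: assms(1))
  have p1: "real q powr ((real n - 1) / 2) = sqrt (real q ^ (n - 1))"
    using n by (intro powr_half_eq_sqrt q) (simp add: of_nat_diff)
  have p2: "real q powr (real n / 2 - 1) = sqrt (real q ^ (n - 2))"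
    using n by (intro powr_half_eq_sqrt q) (simp add: of_nat_diff field_simps)
  have n': "CARD('n) \<ge> 2" and q': "odd CARD('a)" using n assms by auto
  note bounds = isoperimetric_Um_lower[where 'a='a, OF n', unfolded assms(1,3)]
    isoperimetric_Um_upper[OF n' q', unfolded assms(1,3)]
    isoperimetric_Um0_lower[where 'a='a, OF n', unfolded assms(1,3)]
  have "even n \<Longrightarrow> isoperimetric (Um0 :: (('a ^ 'n) set + ('a ^ 'n) set) graph)
      \<le> ((real q ^ (n - 1) - 1) / (real q - 1) - sqrt (real q ^ (n - 2))) / 2"
    using isoperimetric_Um0_upper[OF n' _ q', unfolded assms(1,3)] .
  with bounds show ?thesis unfolding p1 p2 by auto
qed auto

end
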